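(* Let $(a_{ij})\in\mathbb{Z}^{n\times m}$ be such that for each $i$ the integers $a_{i1},\ldots,a_{im}$ are relatively prime, and let $\alpha_1,\ldots,\alpha_n\in\mathbb{R}$ with $\sum_i\alpha_i=0$. Suppose that for every finite cyclic group $G$ and all independent $G$-valued random variables $Z_1,\ldots,Z_m$, $\sum_{i=1}^n\alpha_iH(\sum_{j=1}^m a_{ij}Z_j)\le0$. Then for every $p\in\mathbb{N}$ and all independent $\mathbb{T}^p$-valued random variables $X_1,\ldots,X_m$ that are absolutely continuous w.r.t. Haar measure, $$\sum_{i=1}^n\alpha_i h\Big(\sum_{j=1}^m a_{ij}X_j\Big)\le0.$$
   Context: $\mathbb{T}$ is the unit circle in $\mathbb{C}$ (a group under multiplication, written additively, so $\sum_j a_{ij}X_j$ means $\prod_j X_j^{a_{ij}}$ componentwise). The Haar measure on $\mathbb{T}^p$ is the pushforward of Lebesgue measure on $[0,1)^p$ under $\phi(\theta_1,\ldots,\theta_p)=(e^{2\pi i\theta_1},\ldots,e^{2\pi i\theta_p})$. For a random variable $Y$ with density $f$ w.r.t. a Haar measure $\nu$, $h(Y)=\int f\log\frac1f\,d\nu$. $H$ is Shannon entropy. Standing assumption: all entropies appearing exist and are finite. *)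

theory Defs
  imports "HOL-Probability.Probability"
begin

definition torus :: "nat \<Rightarrow> (nat \<Rightarrow> complex) set" where
  "torus p = (\<Pi>\<^sub>E i\<in>{..<p}. {z. cmod z = 1})"

definition haar :: "nat \<Rightarrow> (nat \<Rightarrow> complex) measure" where
  "haar p = distr (\<Pi>\<^sub>M i\<in>{..<p}. restrict_space lborel {0..<1::real})
                  (\<Pi>\<^sub>M i\<in>{..<p}. (borel :: complex measure))
                  (\<lambda>\<theta>. \<lambda>i\<in>{..<p}. cis (2 * pi * \<theta> i))"

text \<open>The group element  sum_j c_j x_j  in T^p (group written additively),
  i.e. the componentwise product  prod_j x_j^(c_j).\<close>

definition torus_lincomb :: "nat \<Rightarrow> nat \<Rightarrow> (nat \<Rightarrow> int) \<Rightarrow> (nat \<Rightarrow> nat \<Rightarrow> complex) \<Rightarrow> nat \<Rightarrow> complex" where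
  "torus_lincomb p m c x = (\<lambda>i\<in>{..<p}. \<Prod>j<m. (x j i) powi (c j))"

end

theory Submission
  imports Defs "HOL-Real_Asymp.Real_Asymp" "HOL-Complex_Analysis.Cauchy_Integral_Theorem"
    "HOL-Number_Theory.Cong"
begin

text \<open>
  Cut the torus into a grid of \<open>K = \<Prod>i<p. k\<^sub>i\<close> congruent boxes, with distinct primes \<open>k\<^sub>i \<rightarrow> \<infinity>\<close>, so that
  the grid points form a cyclic group, and round every \<open>X\<^sub>j\<close> down to the grid. With \<open>S\<close> the sum
  \<open>\<Sum>j. a\<^sub>j [X\<^sub>j]\<close> of the rounded variables and \<open>Y = \<Sum>j. a\<^sub>j X\<^sub>j\<close>, it suffices to show that
  \<open>H(S) - log K \<rightarrow> h(Y)\<close>, because \<open>\<Sum>i. \<alpha>\<^sub>i = 0\<close> makes the terms \<open>log K\<close> cancel.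

  The rounded \<open>[Y]\<close> differs from \<open>S\<close> by a carry that takes boundedly many values \<open>e\<close>. By
  Bezout, \<open>\<Sum>j. a\<^sub>j b\<^sub>j = 1\<close>, so translating each \<open>X\<^sub>j\<close> by the grid vector \<open>b\<^sub>j e\<close> translates \<open>S\<close> by \<open>e\<close>.
  Small translations hardly change the absolutely continuous law of \<open>X\<^sub>j\<close> in total variation, hence
  the laws of \<open>S\<close> and \<open>[Y]\<close> are close, and after scaling by \<open>K\<close> both are close in \<open>L\<^sup>1\<close> to the density
  \<open>f\<close> of \<open>Y\<close>. Convergence of the entropies needs uniform integrability of \<open>t log t\<close> on top: the
  law of \<open>S\<close> is dominated by boundedly many translates of the law of \<open>[Y]\<close>, which is a cell
  average of \<open>f\<close>, and Jensen's inequality applies.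
\<close>

section \<open>Entropy of laws on uniform partitions\<close>

text \<open>The hypothesis speaks of cyclic groups only, while a grid with the same k in every
  coordinate would give (Z/k)^p; hence the moduli differ from coordinate to coordinate. The rounded
  sum and the carry are dependent, so the carry cannot be averaged out. It depends, however, only on
  the positions of the X_j inside their boxes, and these survive every translation by a grid vector.
  As e ranges over a finite set that is the same for all grids and b is fixed, the translations by
  b_j e have size O(1/k_i) and tend to the identity; this is where absolute continuity enters.
  Closeness in total variation does not bound a difference of entropies on an alphabet of growing
  size: a small mass may still contribute as much as its product with log K. Therefore t log t is
  cut at a level L. Below L it is bounded and continuous, and L^1 convergence suffices; above L the
  excess is convex and increasing, so that domination and Jensen bound it by an integral over f. The
  level is fixed before the grid is refined.\<close>

definition xlogx :: "real \<Rightarrow> real" where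
  "xlogx t = t * log 2 t"

text \<open>Convexity in tangent form. It is ln u \<le> u - 1 at u = x / y, multiplied by y, so no
  second derivative is needed.\<close>

lemma xlogx_tangent:
  assumes "0 < x" "0 < y"
  shows "xlogx x + (log 2 x + 1 / ln 2) * (y - x) \<le> xlogx y"
proof -
  have "ln (x / y) \<le> x / y - 1"
    using assms by (intro ln_le_minus_one) simp
  hence "y * ln (x / y) \<le> x - y"
    using assms by (simp add: field_simps)
  hence "x * ln x + (ln x + 1) * (y - x) \<le> y * ln y"
    using assms by (simp add: ln_div algebra_simps)
  hence "(x * ln x + (ln x + 1) * (y - x)) / ln 2 \<le> y * ln y / ln 2"
    by (intro divide_right_mono) auto
  thus ?thesis
    by (simp add: xlogx_def log_def add_divide_distrib diff_divide_distrib algebra_simps)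
qed

lemma xlogx_mono:
  assumes "1 \<le> x" "x \<le> y"
  shows "xlogx x \<le> xlogx y"
proof -
  have "0 \<le> (log 2 x + 1 / ln 2) * (y - x)"
    using assms by (intro mult_nonneg_nonneg add_nonneg_nonneg) auto
  thus ?thesis using xlogx_tangent[of x y] assms by linarith
qed

lemma continuous_on_xlogx: "continuous_on {0..} xlogx"
proof -
  have "continuous (at x within {0..}) xlogx" if "0 \<le> x" for x
  proof (cases "x = 0")
    case True
    have "((\<lambda>t::real. t * ln t / ln 2) \<longlongrightarrow> 0) (at_right 0)"
      by real_asymp
    hence "(xlogx \<longlongrightarrow> xlogx 0) (at 0 within {0..})"
      unfolding at_within_Ici_at_right by (simp add: xlogx_def[abs_def] log_def)
    thus ?thesis using True by (simp add: continuous_within)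
  next
    case False
    hence "0 < x" using that by auto
    thus ?thesis unfolding xlogx_def log_def
      by (intro continuous_intros) auto
  qed
  thus ?thesis by (simp add: continuous_on_eq_continuous_within)
qed

text \<open>The slope of t log t is infinite at 0, so no Lipschitz bound holds. Uniform continuity
  on [0, L] is put into the affine form \<eta> + K |s - t|, which can be integrated and turns L^1
  convergence into convergence of integrals.\<close>

lemma xlogx_trunc_modulus:
  assumes "0 \<le> L" "0 < \<eta>"
  obtains K where "0 \<le> K"
    "\<And>s t. 0 \<le> s \<Longrightarrow> 0 \<le> t \<Longrightarrow> \<bar>xlogx (min s L) - xlogx (min t L)\<bar> \<le> \<eta> + K * \<bar>s - t\<bar>"
proof -
  have cont: "continuous_on {0..L} xlogx"
    using continuous_on_xlogx by (rule continuous_on_subset) auto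
  hence "uniformly_continuous_on {0..L} xlogx"
    by (intro compact_uniformly_continuous) auto
  then obtain d where d: "d > 0"
    "\<And>s t. s \<in> {0..L} \<Longrightarrow> t \<in> {0..L} \<Longrightarrow> dist s t < d \<Longrightarrow> dist (xlogx s) (xlogx t) < \<eta>"
    using assms(2) unfolding uniformly_continuous_on_def by (metis dist_commute)
  have "bounded (xlogx ` {0..L})"
    by (intro compact_imp_bounded compact_continuous_image cont) auto
  then obtain B where B: "\<And>s. s \<in> {0..L} \<Longrightarrow> \<bar>xlogx s\<bar> \<le> B"
    unfolding bounded_iff by (metis imageI real_norm_def)
  have B0: "0 \<le> B" using B[of 0] assms(1) by auto
  show ?thesis
  \<comment> \<open>If the truncated arguments are at distance at least d, the trivial bound 2 B is
    at most (2 B / d) |s - t|; otherwise \<eta> alone suffices.\<close>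
  proof (rule that[of "2 * B / d"])
    show "0 \<le> 2 * B / d" using B0 d by simp
    fix s t :: real assume st: "0 \<le> s" "0 \<le> t"
    define s' t' where "s' = min s L" and "t' = min t L"
    have in': "s' \<in> {0..L}" "t' \<in> {0..L}"
      using st assms by (auto simp: s'_def t'_def)
    have le: "\<bar>s' - t'\<bar> \<le> \<bar>s - t\<bar>" by (auto simp: s'_def t'_def)
    have "\<bar>xlogx s' - xlogx t'\<bar> \<le> \<eta> + 2 * B / d * \<bar>s - t\<bar>"
    proof (cases "\<bar>s' - t'\<bar> < d")
      case True
      hence "\<bar>xlogx s' - xlogx t'\<bar> \<le> \<eta>"
        using d(2)[OF in'] by (auto simp: dist_real_def)
      moreover have "0 \<le> 2 * B / d * \<bar>s - t\<bar>" using B0 d by simp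
      ultimately show ?thesis by linarith
    next
      case False
      hence "d \<le> \<bar>s - t\<bar>" using le by linarith
      hence "2 * B / d * d \<le> 2 * B / d * \<bar>s - t\<bar>"
        using B0 d by (intro mult_left_mono) auto
      moreover have "2 * B / d * d = 2 * B" using d by simp
      moreover have "\<bar>xlogx s' - xlogx t'\<bar> \<le> 2 * B"
        using B[OF in'(1)] B[OF in'(2)] by linarith
      ultimately show ?thesis using assms(2) by linarith
    qed
    thus "\<bar>xlogx (min s L) - xlogx (min t L)\<bar> \<le> \<eta> + 2 * B / d * \<bar>s - t\<bar>"
      by (simp add: s'_def t'_def)
  qed
qed

text \<open>The excess of t log t above the level L. Unlike t log t, which decreases near 0, it is
  nonnegative, increasing and convex as soon as L \<ge> 1.\<close>

definition xlogx_tail :: "real \<Rightarrow> real \<Rightarrow> real" where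
  "xlogx_tail L t = xlogx (max t L) - xlogx L"

lemma xlogx_split: "xlogx t = xlogx (min t L) + xlogx_tail L t"
  by (auto simp: xlogx_tail_def min_def max_def)

lemma xlogx_tail_eq_0: "t \<le> L \<Longrightarrow> xlogx_tail L t = 0"
  by (simp add: xlogx_tail_def)

lemma xlogx_tail_mono: "1 \<le> L \<Longrightarrow> s \<le> t \<Longrightarrow> xlogx_tail L s \<le> xlogx_tail L t"
  unfolding xlogx_tail_def by (auto intro!: xlogx_mono simp: max_def)

lemma xlogx_tail_nonneg: "1 \<le> L \<Longrightarrow> 0 \<le> xlogx_tail L t"
  using xlogx_tail_mono[of L "min t L" t] by (simp add: xlogx_tail_eq_0)

lemma xlogx_tail_le: "1 \<le> L \<Longrightarrow> xlogx_tail L t \<le> \<bar>xlogx t\<bar>"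
  using xlogx_mono[of 1 L] by (auto simp: xlogx_tail_def max_def) (auto simp: xlogx_def)

lemma measurable_xlogx [measurable]: "xlogx \<in> borel_measurable borel"
  unfolding xlogx_def by measurable

lemma measurable_xlogx_tail [measurable]: "xlogx_tail L \<in> borel_measurable borel"
  unfolding xlogx_tail_def by measurable

text \<open>Convexity across the kink at L: slope 0 serves up to L, the tangent of t log t beyond
  it. In this form it yields Jensen both for finite averages and for integrals over a cell.\<close>

lemma xlogx_tail_supporting_line:
  assumes "1 \<le> L"
  obtains c where "\<And>y. xlogx_tail L x + c * (y - x) \<le> xlogx_tail L y"
proof (cases "x \<le> L")
  case True
  show ?thesis
    by (rule that[of 0]) (use True assms in \<open>auto simp: xlogx_tail_eq_0 xlogx_tail_nonneg\<close>)
next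
  case False
  define c where "c = log 2 x + 1 / ln 2"
  have "0 \<le> c" using False assms by (auto simp: c_def intro!: add_nonneg_nonneg)
  have "xlogx_tail L x + c * (y - x) \<le> xlogx_tail L y" for y
  proof -
    have "xlogx x + c * (max y L - x) \<le> xlogx (max y L)"
      unfolding c_def using False assms by (intro xlogx_tangent) auto
    moreover have "c * (y - x) \<le> c * (max y L - x)"
      using \<open>0 \<le> c\<close> by (intro mult_left_mono) auto
    ultimately show ?thesis using False by (auto simp: xlogx_tail_def)
  qed
  thus ?thesis by (rule that)
qed

text \<open>Jensen for the uniform average on E: the sum of the t e is the average of the numbers
  card E * t e.\<close>

lemma xlogx_tail_sum_le:
  assumes "1 \<le> L" "finite E" "E \<noteq> {}"
  shows "xlogx_tail L (\<Sum>e\<in>E. t e) \<le> (\<Sum>e\<in>E. xlogx_tail L (real (card E) * t e)) / card E"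
proof -
  define C where "C = real (card E)"
  have C: "C > 0" using assms by (simp add: C_def card_gt_0_iff)
  obtain c where c: "\<And>y. xlogx_tail L (\<Sum>e\<in>E. t e) + c * (y - (\<Sum>e\<in>E. t e)) \<le> xlogx_tail L y"
    using xlogx_tail_supporting_line[OF assms(1)] by blast
  have "(\<Sum>e\<in>E. xlogx_tail L (\<Sum>e\<in>E. t e) + c * (C * t e - (\<Sum>e\<in>E. t e)))
      \<le> (\<Sum>e\<in>E. xlogx_tail L (C * t e))"
    by (intro sum_mono c)
  also have "(\<Sum>e\<in>E. xlogx_tail L (\<Sum>e\<in>E. t e) + c * (C * t e - (\<Sum>e\<in>E. t e)))
      = C * xlogx_tail L (\<Sum>e\<in>E. t e) + c * (C * (\<Sum>e\<in>E. t e) - C * (\<Sum>e\<in>E. t e))"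
    by (simp add: sum.distrib sum_subtractf sum_distrib_left C_def algebra_simps)
  finally show ?thesis using C by (simp add: field_simps flip: C_def)
qed

section \<open>Partitions of a probability space into cells of equal mass\<close>

locale uniform_partition = prob_space \<nu> for \<nu> :: "'b measure" +
  fixes k :: nat and cell :: "'b \<Rightarrow> int"
  assumes k_pos: "0 < k"
    and cell_measurable [measurable]: "cell \<in> \<nu> \<rightarrow>\<^sub>M count_space UNIV"
    and cell_range: "\<And>x. x \<in> space \<nu> \<Longrightarrow> cell x \<in> {0..<int k}"
    and cell_measure: "\<And>s. s \<in> {0..<int k} \<Longrightarrow> prob {x \<in> space \<nu>. cell x = s} = 1 / k"
begin

text \<open>For a density f this is the probability of the cell s; since a cell has mass 1 / k,
  multiplication by k gives the mean of f over the cell.\<close>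

definition cell_integral :: "('b \<Rightarrow> real) \<Rightarrow> int \<Rightarrow> real" where
  "cell_integral f s = (\<integral>x. f x * indicator {s} (cell x) \<partial>\<nu>)"

lemma integrable_mult_cell [intro]:
  fixes f :: "'b \<Rightarrow> real"
  assumes "integrable \<nu> f"
  shows "integrable \<nu> (\<lambda>x. f x * indicator A (cell x))"
proof (rule Bochner_Integration.integrable_bound[OF assms])
  have "(\<lambda>x. indicator A (cell x) :: real) \<in> borel_measurable \<nu>"
    by (rule measurable_compose[OF cell_measurable]) simp
  thus "(\<lambda>x. f x * indicator A (cell x)) \<in> borel_measurable \<nu>"
    using assms by (intro borel_measurable_times) auto
qed (auto simp: indicator_def)

lemma sum_cell_integral:
  assumes "integrable \<nu> f"
  shows "(\<Sum>s\<in>{0..<int k}. cell_integral f s) = (\<integral>x. f x \<partial>\<nu>)"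
proof -
  have "(\<Sum>s\<in>{0..<int k}. cell_integral f s)
      = (\<integral>x. (\<Sum>s\<in>{0..<int k}. f x * indicator {s} (cell x)) \<partial>\<nu>)"
    unfolding cell_integral_def by (rule Bochner_Integration.integral_sum[symmetric]) (use assms in auto)
  also have "\<dots> = (\<integral>x. f x \<partial>\<nu>)"
  proof (rule Bochner_Integration.integral_cong[OF refl])
    fix x assume "x \<in> space \<nu>"
    thus "(\<Sum>s\<in>{0..<int k}. f x * indicator {s} (cell x)) = f x"
      using cell_range[of x] by (simp add: indicator_def of_bool_def if_distrib sum.delta cong: if_cong)
  qed
  finally show ?thesis .
qed

lemma cell_integral_step:
  assumes "s \<in> {0..<int k}"
  shows "cell_integral (\<lambda>x. g (cell x)) s = g s / k"
proof -
  have "cell_integral (\<lambda>x. g (cell x)) s = (\<integral>x. g s * indicator {x \<in> space \<nu>. cell x = s} x \<partial>\<nu>)"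
    unfolding cell_integral_def by (intro Bochner_Integration.integral_cong) (auto simp: indicator_def)
  also have "\<dots> = g s / k"
    using cell_measure[OF assms] by simp
  finally show ?thesis .
qed

lemma integrable_step [intro, simp]:
  fixes g :: "int \<Rightarrow> real"
  shows "integrable \<nu> (\<lambda>x. g (cell x))"
proof (rule integrable_const_bound)
  show "AE x in \<nu>. norm (g (cell x)) \<le> (\<Sum>s\<in>{0..<int k}. \<bar>g s\<bar>)"
    using cell_range by (intro AE_I2) (auto intro!: member_le_sum)
qed measurable

lemma integral_step: "(\<integral>x. g (cell x) \<partial>\<nu>) = (\<Sum>s\<in>{0..<int k}. g s) / k"
  using sum_cell_integral[of "\<lambda>x. g (cell x)"]
  by (simp add: cell_integral_step sum_divide_distrib)

text \<open>Jensen on a single cell: the supporting line at the mean of f is integrated over the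
  cell, where its linear term cancels.\<close>

lemma xlogx_tail_cell_integral_le:
  assumes L: "1 \<le> L" and f: "integrable \<nu> f" and tail: "integrable \<nu> (\<lambda>x. xlogx_tail L (f x))"
    and s: "s \<in> {0..<int k}"
  shows "xlogx_tail L (k * cell_integral f s) / k \<le> cell_integral (\<lambda>x. xlogx_tail L (f x)) s"
proof -
  define m where "m = k * cell_integral f s"
  obtain c where c: "\<And>y. xlogx_tail L m + c * (y - m) \<le> xlogx_tail L y"
    using xlogx_tail_supporting_line[OF L] by blast
  have one: "(\<integral>x. indicator {s} (cell x) \<partial>\<nu>) = 1 / real k"
    using cell_integral_step[OF s, of "\<lambda>_. 1"] by (simp add: cell_integral_def)
  have int1: "integrable \<nu> (\<lambda>x. indicator {s} (cell x) :: real)" by (rule integrable_step)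
  have "(\<integral>x. (xlogx_tail L m - c * m) * indicator {s} (cell x) + c * (f x * indicator {s} (cell x)) \<partial>\<nu>)
      \<le> cell_integral (\<lambda>x. xlogx_tail L (f x)) s"
    unfolding cell_integral_def
  proof (rule integral_mono)
    show "(xlogx_tail L m - c * m) * indicator {s} (cell x) + c * (f x * indicator {s} (cell x))
        \<le> xlogx_tail L (f x) * indicator {s} (cell x)" for x
      using c[of "f x"] by (auto simp: indicator_def algebra_simps)
  next
    show "integrable \<nu> (\<lambda>x. (xlogx_tail L m - c * m) * indicator {s} (cell x) + c * (f x * indicator {s} (cell x)))"
      using integrable_mult_cell[OF f] int1
      by (intro Bochner_Integration.integrable_add integrable_mult_right)
    show "integrable \<nu> (\<lambda>x. xlogx_tail L (f x) * indicator {s} (cell x))"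
      by (rule integrable_mult_cell[OF tail])
  qed
  also have "(\<integral>x. (xlogx_tail L m - c * m) * indicator {s} (cell x) + c * (f x * indicator {s} (cell x)) \<partial>\<nu>)
      = (xlogx_tail L m - c * m) / k + c * cell_integral f s"
    using integrable_mult_cell[OF f, of "{s}"] int1
    by (subst Bochner_Integration.integral_add)
      (simp_all only: integrable_mult_right integral_mult_right_zero one cell_integral_def, simp)
  also have "\<dots> = xlogx_tail L m / k"
    using k_pos by (simp add: m_def field_simps)
  finally show ?thesis by (simp add: m_def)
qed

text \<open>Averaging over cells is an L^1 contraction that fixes step functions. So the averages of
  f are, up to the factor 2, as good as any other step function, and a convenient \<open>g\<close>
  may be chosen by hand.\<close>

lemma abs_diff_cell_average_le:
  assumes f: "integrable \<nu> f"
  shows "(\<integral>x. \<bar>f x - k * cell_integral f (cell x)\<bar> \<partial>\<nu>) \<le> 2 * (\<integral>x. \<bar>f x - g (cell x)\<bar> \<partial>\<nu>)"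
proof -
  have int: "integrable \<nu> (\<lambda>x. f x - g (cell x))" using f by auto
  have "\<bar>g s / k - cell_integral f s\<bar> \<le> cell_integral (\<lambda>x. \<bar>f x - g (cell x)\<bar>) s"
    if s: "s \<in> {0..<int k}" for s
  proof -
    have "g s / k - cell_integral f s = (\<integral>x. (g (cell x) - f x) * indicator {s} (cell x) \<partial>\<nu>)"
      unfolding cell_integral_step[OF s, symmetric] cell_integral_def
      using f by (subst Bochner_Integration.integral_diff[symmetric]) (auto simp: algebra_simps)
    also have "\<bar>\<dots>\<bar> \<le> (\<integral>x. \<bar>(g (cell x) - f x) * indicator {s} (cell x)\<bar> \<partial>\<nu>)"
      by (rule integral_abs_bound)
    also have "\<dots> = cell_integral (\<lambda>x. \<bar>f x - g (cell x)\<bar>) s"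
      unfolding cell_integral_def
      by (intro Bochner_Integration.integral_cong) (auto simp: abs_mult abs_minus_commute)
    finally show ?thesis .
  qed
  hence "(\<Sum>s\<in>{0..<int k}. \<bar>g s / k - cell_integral f s\<bar>) \<le> (\<integral>x. \<bar>f x - g (cell x)\<bar> \<partial>\<nu>)"
    using int by (subst sum_cell_integral[symmetric]) (auto intro!: sum_mono)
  moreover have "(\<integral>x. \<bar>g (cell x) - k * cell_integral f (cell x)\<bar> \<partial>\<nu>)
      = (\<Sum>s\<in>{0..<int k}. \<bar>g s / k - cell_integral f s\<bar>)"
  proof -
    have "\<bar>g s - k * cell_integral f s\<bar> / k = \<bar>g s / k - cell_integral f s\<bar>" for s
    proof -
      have "g s / k - cell_integral f s = (g s - k * cell_integral f s) / k"
        using k_pos by (simp add: field_simps)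
      thus ?thesis by (simp add: abs_divide)
    qed
    thus ?thesis
      using integral_step[of "\<lambda>s. \<bar>g s - k * cell_integral f s\<bar>"]
      by (simp add: sum_divide_distrib)
  qed
  moreover have "(\<integral>x. \<bar>f x - k * cell_integral f (cell x)\<bar> \<partial>\<nu>)
     \<le> (\<integral>x. \<bar>f x - g (cell x)\<bar> + \<bar>g (cell x) - k * cell_integral f (cell x)\<bar> \<partial>\<nu>)"
    using int f by (intro integral_mono) auto
  moreover have "\<dots> = (\<integral>x. \<bar>f x - g (cell x)\<bar> \<partial>\<nu>) + (\<integral>x. \<bar>g (cell x) - k * cell_integral f (cell x)\<bar> \<partial>\<nu>)"
    using int f by (intro Bochner_Integration.integral_add) auto
  ultimately show ?thesis by linarith
qed

text \<open>The law \<open>r\<close> is close in total variation to the law of the cell of a random element with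
  density \<open>f\<close>; the domination by shifts of the latter law controls the large values of \<open>r\<close>, which
  total variation alone does not.\<close>

lemma xlogx_sum_close:
  fixes E :: "'e set" and \<sigma> :: "'e \<Rightarrow> int \<Rightarrow> int" and r :: "int \<Rightarrow> real"
  assumes f: "integrable \<nu> f" and f_nonneg: "\<And>x. x \<in> space \<nu> \<Longrightarrow> 0 \<le> f x"
    and xlogx_f: "integrable \<nu> (\<lambda>x. xlogx (f x))"
    and L: "1 \<le> L" and tail_int: "integrable \<nu> (\<lambda>x. xlogx_tail L (real (card E) * f x))"
    and E: "finite E" "E \<noteq> {}"
    and \<sigma>: "\<And>e. e \<in> E \<Longrightarrow> bij_betw (\<sigma> e) {0..<int k} {0..<int k}"
    and r_nonneg: "\<And>s. 0 \<le> r s"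
    and dom: "\<And>s. s \<in> {0..<int k} \<Longrightarrow> r s \<le> (\<Sum>e\<in>E. cell_integral f (\<sigma> e s))"
    and K: "0 \<le> K"
      "\<And>s t. 0 \<le> s \<Longrightarrow> 0 \<le> t \<Longrightarrow> \<bar>xlogx (min s L) - xlogx (min t L)\<bar> \<le> \<eta> + K * \<bar>s - t\<bar>"
  shows "\<bar>(\<Sum>s\<in>{0..<int k}. xlogx (k * r s)) / k - (\<integral>x. xlogx (f x) \<partial>\<nu>)\<bar>
    \<le> 2 * (\<integral>x. xlogx_tail L (real (card E) * f x) \<partial>\<nu>) + \<eta>
      + K * ((\<integral>x. \<bar>f x - k * cell_integral f (cell x)\<bar> \<partial>\<nu>)
             + (\<Sum>s\<in>{0..<int k}. \<bar>r s - cell_integral f s\<bar>))"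
proof -
  define q where "q = cell_integral f"
  define C where "C = real (card E)"
  have C: "1 \<le> C" using E by (simp add: C_def Suc_le_eq card_gt_0_iff)
  note [simp] = xlogx_tail_nonneg[OF L]
  have f_meas [measurable]: "f \<in> borel_measurable \<nu>" using f by auto

  have trunc_int: "integrable \<nu> (\<lambda>x. xlogx (min (f x) L))"
  proof (rule Bochner_Integration.integrable_bound[of _ "\<lambda>x. \<bar>xlogx (f x)\<bar> + \<bar>xlogx L\<bar>"])
    show "integrable \<nu> (\<lambda>x. \<bar>xlogx (f x)\<bar> + \<bar>xlogx L\<bar>)" using xlogx_f by auto
  qed (auto simp: min_def)
  have tail_f_int: "integrable \<nu> (\<lambda>x. xlogx_tail L (f x))"
  proof -
    have "integrable \<nu> (\<lambda>x. xlogx (f x) - xlogx (min (f x) L))" using xlogx_f trunc_int by auto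
    thus ?thesis by (subst (asm) xlogx_split[of _ L]) simp
  qed

  \<comment> \<open>Jensen is used twice, first over E and then on every cell. In between, each
    bijection \<open>\<sigma> e\<close> merely reorders the cells, so the sum over E consists of C
    equal terms and cancels the divisor C.\<close>
  have tail_r: "(\<Sum>s\<in>{0..<int k}. xlogx_tail L (k * r s)) / k \<le> (\<integral>x. xlogx_tail L (C * f x) \<partial>\<nu>)"
  proof -
    have "xlogx_tail L (k * r s) \<le> (\<Sum>e\<in>E. xlogx_tail L (C * (k * q (\<sigma> e s)))) / C"
      if s: "s \<in> {0..<int k}" for s
    proof -
      have "k * r s \<le> (\<Sum>e\<in>E. k * q (\<sigma> e s))"
        using mult_left_mono[OF dom[OF s], of "real k"] by (simp add: q_def sum_distrib_left)
      hence "xlogx_tail L (k * r s) \<le> xlogx_tail L (\<Sum>e\<in>E. k * q (\<sigma> e s))"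
        using L by (intro xlogx_tail_mono) auto
      also have "\<dots> \<le> (\<Sum>e\<in>E. xlogx_tail L (C * (k * q (\<sigma> e s)))) / C"
        unfolding C_def by (rule xlogx_tail_sum_le[OF L E])
      finally show ?thesis .
    qed
    hence "(\<Sum>s\<in>{0..<int k}. xlogx_tail L (k * r s))
        \<le> (\<Sum>s\<in>{0..<int k}. (\<Sum>e\<in>E. xlogx_tail L (C * (k * q (\<sigma> e s)))) / C)"
      by (rule sum_mono)
    also have "\<dots> = (\<Sum>e\<in>E. \<Sum>s\<in>{0..<int k}. xlogx_tail L (C * (k * q (\<sigma> e s)))) / C"
      unfolding sum_divide_distrib[symmetric] by (subst sum.swap) (rule refl)
    also have "(\<Sum>e\<in>E. \<Sum>s\<in>{0..<int k}. xlogx_tail L (C * (k * q (\<sigma> e s))))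
        = (\<Sum>e\<in>E. \<Sum>s\<in>{0..<int k}. xlogx_tail L (C * (k * q s)))"
      by (intro sum.cong refl sum.reindex_bij_betw \<sigma>)
    also have "\<dots> / C = (\<Sum>s\<in>{0..<int k}. xlogx_tail L (C * (k * q s)))"
      using C by (simp add: C_def)
    also have "\<dots> / k \<le> (\<Sum>s\<in>{0..<int k}. cell_integral (\<lambda>x. xlogx_tail L (C * f x)) s)"
      unfolding sum_divide_distrib
    proof (rule sum_mono)
      fix s assume s: "s \<in> {0..<int k}"
      have "cell_integral (\<lambda>x. C * f x) s = C * q s"
        by (simp add: cell_integral_def q_def mult.assoc)
      thus "xlogx_tail L (C * (k * q s)) / k \<le> cell_integral (\<lambda>x. xlogx_tail L (C * f x)) s"
        using xlogx_tail_cell_integral_le[OF L _ tail_int s] f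
        by (simp add: C_def mult.left_commute)
    qed
    also have "\<dots> = (\<integral>x. xlogx_tail L (C * f x) \<partial>\<nu>)"
      using tail_int by (intro sum_cell_integral) (simp add: C_def)
    finally show ?thesis by (auto simp: divide_right_mono)
  qed
  have tail_f: "(\<integral>x. xlogx_tail L (f x) \<partial>\<nu>) \<le> (\<integral>x. xlogx_tail L (C * f x) \<partial>\<nu>)"
  proof (rule integral_mono)
    fix x assume "x \<in> space \<nu>"
    hence "f x \<le> C * f x" using mult_right_mono[OF C f_nonneg] by auto
    thus "xlogx_tail L (f x) \<le> xlogx_tail L (C * f x)" using L by (intro xlogx_tail_mono)
  qed (use tail_f_int tail_int C_def in auto)

  have q_int: "integrable \<nu> (\<lambda>x. \<bar>f x - k * q (cell x)\<bar>)" using f by auto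
  \<comment> \<open>The normalised sum is itself an integral, namely of the step function k r(cell
    x), so the two terms can be compared pointwise.\<close>
  have "\<bar>(\<Sum>s\<in>{0..<int k}. xlogx (min (k * r s) L)) / k - (\<integral>x. xlogx (min (f x) L) \<partial>\<nu>)\<bar>
      = \<bar>\<integral>x. xlogx (min (k * r (cell x)) L) - xlogx (min (f x) L) \<partial>\<nu>\<bar>"
    using trunc_int integral_step[of "\<lambda>s. xlogx (min (k * r s) L)"]
      integrable_step[of "\<lambda>s. xlogx (min (k * r s) L)"]
    by (subst Bochner_Integration.integral_diff) auto
  also have "\<dots> \<le> (\<integral>x. \<bar>xlogx (min (k * r (cell x)) L) - xlogx (min (f x) L)\<bar> \<partial>\<nu>)"
    by (rule integral_abs_bound)
  also have "\<dots> \<le> (\<integral>x. \<eta> + K * (\<bar>f x - k * q (cell x)\<bar> + k * \<bar>r (cell x) - q (cell x)\<bar>) \<partial>\<nu>)"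
  proof (rule integral_mono)
    fix x assume x: "x \<in> space \<nu>"
    have "\<bar>k * r (cell x) - f x\<bar> \<le> \<bar>f x - k * q (cell x)\<bar> + \<bar>k * (r (cell x) - q (cell x))\<bar>"
      by (simp add: algebra_simps)
    also have "\<bar>k * (r (cell x) - q (cell x))\<bar> = k * \<bar>r (cell x) - q (cell x)\<bar>"
      by (simp add: abs_mult)
    finally have "K * \<bar>k * r (cell x) - f x\<bar> \<le> K * (\<bar>f x - k * q (cell x)\<bar> + k * \<bar>r (cell x) - q (cell x)\<bar>)"
      using K(1) by (intro mult_left_mono)
    thus "\<bar>xlogx (min (k * r (cell x)) L) - xlogx (min (f x) L)\<bar>
        \<le> \<eta> + K * (\<bar>f x - k * q (cell x)\<bar> + k * \<bar>r (cell x) - q (cell x)\<bar>)"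
      using K(2)[of "k * r (cell x)" "f x"] f_nonneg[OF x] r_nonneg by (auto intro: order_trans)
  next
    show "integrable \<nu> (\<lambda>x. \<bar>xlogx (min (k * r (cell x)) L) - xlogx (min (f x) L)\<bar>)"
      using trunc_int integrable_step[of "\<lambda>s. xlogx (min (k * r s) L)"] by auto
    show "integrable \<nu> (\<lambda>x. \<eta> + K * (\<bar>f x - k * q (cell x)\<bar> + k * \<bar>r (cell x) - q (cell x)\<bar>))"
      using q_int integrable_step[of "\<lambda>s. k * \<bar>r s - q s\<bar>"] by auto
  qed
  also have "\<dots> = \<eta> + K * ((\<integral>x. \<bar>f x - k * q (cell x)\<bar> \<partial>\<nu>) + (\<Sum>s\<in>{0..<int k}. \<bar>r s - q s\<bar>))"
    using q_int integrable_step[of "\<lambda>s. k * \<bar>r s - q s\<bar>"] integral_step[of "\<lambda>s. k * \<bar>r s - q s\<bar>"] k_pos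
    by (simp add: prob_space sum_distrib_left[symmetric])
  finally have trunc: "\<bar>(\<Sum>s\<in>{0..<int k}. xlogx (min (k * r s) L)) / k - (\<integral>x. xlogx (min (f x) L) \<partial>\<nu>)\<bar>
      \<le> \<eta> + K * ((\<integral>x. \<bar>f x - k * q (cell x)\<bar> \<partial>\<nu>) + (\<Sum>s\<in>{0..<int k}. \<bar>r s - q s\<bar>))" .

  have arith: "\<bar>a + t - (b + u)\<bar> \<le> 2 * T + d"
    if "\<bar>a - b\<bar> \<le> d" "t \<le> T" "u \<le> T" "0 \<le> t" "0 \<le> u" for a b t u T d :: real
    using that by linarith
  have "(\<Sum>s\<in>{0..<int k}. xlogx (k * r s)) / k
      = (\<Sum>s\<in>{0..<int k}. xlogx (min (k * r s) L)) / k + (\<Sum>s\<in>{0..<int k}. xlogx_tail L (k * r s)) / k"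
    by (subst xlogx_split[of _ L]) (simp add: sum.distrib add_divide_distrib)
  moreover have "(\<integral>x. xlogx (f x) \<partial>\<nu>) = (\<integral>x. xlogx (min (f x) L) \<partial>\<nu>) + (\<integral>x. xlogx_tail L (f x) \<partial>\<nu>)"
    by (subst xlogx_split[of _ L]) (rule Bochner_Integration.integral_add[OF trunc_int tail_f_int])
  moreover have "0 \<le> (\<Sum>s\<in>{0..<int k}. xlogx_tail L (k * r s)) / k"
    by (intro divide_nonneg_nonneg sum_nonneg) auto
  moreover have "0 \<le> (\<integral>x. xlogx_tail L (f x) \<partial>\<nu>)" by simp
  ultimately show ?thesis
    using arith[OF trunc tail_r tail_f] unfolding q_def C_def
    by (simp only: add.assoc)
qed

end

section \<open>Vanishing tails and passage to the limit\<close>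

lemma xlogx_tail_integral_tendsto_0:
  fixes c :: real
  assumes f: "integrable \<nu> f" and f_nonneg: "\<And>x. x \<in> space \<nu> \<Longrightarrow> 0 \<le> f x"
    and xlogx_f: "integrable \<nu> (\<lambda>x. xlogx (f x))" and c: "0 < c"
  shows "((\<lambda>n. \<integral>x. xlogx_tail (Suc n) (c * f x) \<partial>\<nu>) \<longlonglongrightarrow> 0)"
    and "\<And>n. integrable \<nu> (\<lambda>x. xlogx_tail (Suc n) (c * f x))"
proof -
  have [measurable]: "f \<in> borel_measurable \<nu>" using f by auto
  \<comment> \<open>Multiplying the argument of t log t by c only adds a multiple of t, so
    integrability passes from f to c f.\<close>
  have "integrable \<nu> (\<lambda>x. c * log 2 c * f x + c * xlogx (f x))"
    using f xlogx_f by auto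
  also have "?this \<longleftrightarrow> integrable \<nu> (\<lambda>x. xlogx (c * f x))"
  proof (rule Bochner_Integration.integrable_cong[OF refl])
    fix x assume "x \<in> space \<nu>"
    thus "c * log 2 c * f x + c * xlogx (f x) = xlogx (c * f x)"
      using f_nonneg[of x] c
      by (cases "f x = 0") (auto simp: xlogx_def log_mult algebra_simps)
  qed
  finally have int: "integrable \<nu> (\<lambda>x. \<bar>xlogx (c * f x)\<bar>)" by auto
  have bound: "norm (xlogx_tail (Suc n) (c * f x)) \<le> \<bar>xlogx (c * f x)\<bar>" for n x
    using xlogx_tail_nonneg[of "Suc n" "c * f x"] xlogx_tail_le[of "Suc n" "c * f x"] by auto
  show "integrable \<nu> (\<lambda>x. xlogx_tail (Suc n) (c * f x))" for n
    using int by (rule Bochner_Integration.integrable_bound) (use bound in auto)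
  \<comment> \<open>At each point the tail is 0 once the level exceeds c f(x). The successor keeps
    every level at least 1, as the bound by |t log t| requires.\<close>
  have "((\<lambda>n. \<integral>x. xlogx_tail (Suc n) (c * f x) \<partial>\<nu>) \<longlonglongrightarrow> (\<integral>x. 0 \<partial>\<nu>))"
  proof (rule integral_dominated_convergence[OF _ _ int])
    show "AE x in \<nu>. (\<lambda>n. xlogx_tail (real (Suc n)) (c * f x)) \<longlonglongrightarrow> 0"
    proof (rule AE_I2)
      fix x
      obtain n0 where "c * f x < real n0" using reals_Archimedean2 by blast
      hence "eventually (\<lambda>n. xlogx_tail (real (Suc n)) (c * f x) = 0) sequentially"
        by (intro eventually_sequentiallyI[of n0] xlogx_tail_eq_0) auto
      thus "(\<lambda>n. xlogx_tail (real (Suc n)) (c * f x)) \<longlonglongrightarrow> 0" by (rule tendsto_eventually)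
    qed
  qed (use bound in auto)
  thus "((\<lambda>n. \<integral>x. xlogx_tail (Suc n) (c * f x) \<partial>\<nu>) \<longlonglongrightarrow> 0)" by simp
qed

text \<open>The order of choices matters: the level L comes from the tails of card E * f, then K
  from the modulus on [0, L], and N last. This works because E is the same for all N.\<close>

proposition xlogx_sum_tendsto:
  fixes E :: "'e set" and k :: "nat \<Rightarrow> nat" and cell :: "nat \<Rightarrow> 'b \<Rightarrow> int"
    and r :: "nat \<Rightarrow> int \<Rightarrow> real"
  assumes part: "\<And>N. uniform_partition \<nu> (k N) (cell N)"
    and f: "integrable \<nu> f" and f_nonneg: "\<And>x. x \<in> space \<nu> \<Longrightarrow> 0 \<le> f x"
    and xlogx_f: "integrable \<nu> (\<lambda>x. xlogx (f x))"
    and E: "finite E" "E \<noteq> {}"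
    and \<sigma>: "\<And>N e. e \<in> E \<Longrightarrow> bij_betw (\<sigma> N e) {0..<int (k N)} {0..<int (k N)}"
    and r_nonneg: "\<And>N s. 0 \<le> r N s"
    and dom: "\<And>N s. s \<in> {0..<int (k N)} \<Longrightarrow>
      r N s \<le> (\<Sum>e\<in>E. uniform_partition.cell_integral \<nu> (cell N) f (\<sigma> N e s))"
    and avg: "(\<lambda>N. \<integral>x. \<bar>f x - k N * uniform_partition.cell_integral \<nu> (cell N) f (cell N x)\<bar> \<partial>\<nu>) \<longlonglongrightarrow> 0"
    and tv: "(\<lambda>N. \<Sum>s\<in>{0..<int (k N)}. \<bar>r N s - uniform_partition.cell_integral \<nu> (cell N) f s\<bar>) \<longlonglongrightarrow> 0"
  shows "(\<lambda>N. (\<Sum>s\<in>{0..<int (k N)}. xlogx (k N * r N s)) / k N) \<longlonglongrightarrow> (\<integral>x. xlogx (f x) \<partial>\<nu>)"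
proof (rule LIMSEQ_I)
  fix \<epsilon> :: real assume \<epsilon>: "0 < \<epsilon>"
  have c: "0 < real (card E)" using E by (simp add: card_gt_0_iff)
  note tail = xlogx_tail_integral_tendsto_0[OF f f_nonneg xlogx_f c]
  \<comment> \<open>The tail integral is counted twice, so it costs \<epsilon> / 4; the modulus and
    the L^1 errors cost another \<epsilon> / 4 each.\<close>
  obtain n where n: "(\<integral>x. xlogx_tail (Suc n) (card E * f x) \<partial>\<nu>) < \<epsilon> / 8"
    using order_tendstoD(2)[OF tail(1), of "\<epsilon> / 8"] \<epsilon>
    by (auto simp: eventually_sequentially)
  define L where "L = real (Suc n)"
  obtain K where K: "0 \<le> K"
      "\<And>s t. 0 \<le> s \<Longrightarrow> 0 \<le> t \<Longrightarrow> \<bar>xlogx (min s L) - xlogx (min t L)\<bar> \<le> \<epsilon> / 4 + K * \<bar>s - t\<bar>"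
    using xlogx_trunc_modulus[of L "\<epsilon> / 4"] \<epsilon> by (auto simp: L_def)
  define d where "d N = (\<integral>x. \<bar>f x - k N * uniform_partition.cell_integral \<nu> (cell N) f (cell N x)\<bar> \<partial>\<nu>)
    + (\<Sum>s\<in>{0..<int (k N)}. \<bar>r N s - uniform_partition.cell_integral \<nu> (cell N) f s\<bar>)" for N
  have "(\<lambda>N. K * d N) \<longlonglongrightarrow> K * (0 + 0)"
    unfolding d_def by (intro tendsto_intros avg tv)
  hence "eventually (\<lambda>N. K * d N < \<epsilon> / 4) sequentially"
    using \<epsilon> by (intro order_tendstoD(2)) auto
  then obtain N0 where N0: "\<And>N. N \<ge> N0 \<Longrightarrow> K * d N < \<epsilon> / 4"
    by (auto simp: eventually_sequentially)
  show "\<exists>N0. \<forall>N\<ge>N0. norm ((\<Sum>s\<in>{0..<int (k N)}. xlogx (k N * r N s)) / k N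
      - (\<integral>x. xlogx (f x) \<partial>\<nu>)) < \<epsilon>"
  proof (intro exI allI impI)
    fix N assume N: "N \<ge> N0"
    interpret uniform_partition \<nu> "k N" "cell N" by (rule part)
    have "\<bar>(\<Sum>s\<in>{0..<int (k N)}. xlogx (k N * r N s)) / k N - (\<integral>x. xlogx (f x) \<partial>\<nu>)\<bar>
      \<le> 2 * (\<integral>x. xlogx_tail L (real (card E) * f x) \<partial>\<nu>) + \<epsilon> / 4 + K * d N"
      unfolding d_def
      by (rule xlogx_sum_close[where \<sigma> = "\<sigma> N"])
        (use f f_nonneg xlogx_f E \<sigma> r_nonneg dom K tail(2) in \<open>auto simp: L_def\<close>)
    thus "norm ((\<Sum>s\<in>{0..<int (k N)}. xlogx (k N * r N s)) / k N - (\<integral>x. xlogx (f x) \<partial>\<nu>)) < \<epsilon>"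
      using n N0[OF N] \<epsilon> by (simp add: L_def)
  qed
qed

section \<open>Uniformly continuous approximation in the mean\<close>

text \<open>Density of uniformly continuous functions in L^1, stated for one \<epsilon> at a time: v
  has to oscillate by at most \<epsilon> at some scale \<delta>. Closeness is measured
  coordinatewise on I, which suits both rotations and boxes.\<close>

definition uc_approximable :: "'i set \<Rightarrow> ('i \<Rightarrow> 'm::metric_space) measure \<Rightarrow> (('i \<Rightarrow> 'm) \<Rightarrow> real) \<Rightarrow> bool" where
  "uc_approximable I \<nu> u \<longleftrightarrow> (\<forall>\<epsilon>>0. \<exists>v \<delta>. integrable \<nu> v \<and> 0 < \<delta> \<and>
     (\<forall>x y. (\<forall>i\<in>I. dist (x i) (y i) < \<delta>) \<longrightarrow> \<bar>v x - v y\<bar> \<le> \<epsilon>) \<and> (\<integral>x. \<bar>u x - v x\<bar> \<partial>\<nu>) \<le> \<epsilon>)"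

lemma uc_approximableE:
  assumes "uc_approximable I \<nu> u" "0 < \<epsilon>"
  obtains v \<delta> where "integrable \<nu> v" "0 < \<delta>"
    "\<And>x y. (\<And>i. i \<in> I \<Longrightarrow> dist (x i) (y i) < \<delta>) \<Longrightarrow> \<bar>v x - v y\<bar> \<le> \<epsilon>"
    "(\<integral>x. \<bar>u x - v x\<bar> \<partial>\<nu>) \<le> \<epsilon>"
proof -
  from assms obtain v \<delta> where *: "integrable \<nu> v \<and> 0 < \<delta> \<and>
     (\<forall>x y. (\<forall>i\<in>I. dist (x i) (y i) < \<delta>) \<longrightarrow> \<bar>v x - v y\<bar> \<le> \<epsilon>) \<and> (\<integral>x. \<bar>u x - v x\<bar> \<partial>\<nu>) \<le> \<epsilon>"
    unfolding uc_approximable_def by blast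
  show ?thesis by (rule that[of v \<delta>]) (use * in auto)
qed

lemma uc_approximable_cong:
  assumes "\<And>x. x \<in> space \<nu> \<Longrightarrow> u x = u' x"
  shows "uc_approximable I \<nu> u \<longleftrightarrow> uc_approximable I \<nu> u'"
proof -
  have "(\<integral>x. \<bar>u x - v x\<bar> \<partial>\<nu>) = (\<integral>x. \<bar>u' x - v x\<bar> \<partial>\<nu>)" for v
    using assms by (intro Bochner_Integration.integral_cong) auto
  thus ?thesis by (simp add: uc_approximable_def)
qed

lemma uc_approximable_const:
  assumes "finite_measure \<nu>"
  shows "uc_approximable I \<nu> (\<lambda>_. c)"
proof -
  interpret finite_measure \<nu> by fact
  show ?thesis
    unfolding uc_approximable_def
    by (intro allI impI exI[of _ "\<lambda>_. c"] exI[of _ 1]) auto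
qed

lemma uc_approximable_add:
  assumes u: "integrable \<nu> u" "integrable \<nu> u'"
    and ap: "uc_approximable I \<nu> u" "uc_approximable I \<nu> u'"
  shows "uc_approximable I \<nu> (\<lambda>x. u x + u' x)"
  unfolding uc_approximable_def
proof (intro allI impI)
  fix \<epsilon> :: real assume "0 < \<epsilon>"
  hence \<epsilon>: "0 < \<epsilon> / 2" by simp
  obtain v \<delta> where v: "integrable \<nu> v" "0 < \<delta>"
    "\<And>x y. (\<And>i. i \<in> I \<Longrightarrow> dist (x i) (y i) < \<delta>) \<Longrightarrow> \<bar>v x - v y\<bar> \<le> \<epsilon> / 2"
    "(\<integral>x. \<bar>u x - v x\<bar> \<partial>\<nu>) \<le> \<epsilon> / 2" using uc_approximableE[OF ap(1) \<epsilon>] by blast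
  obtain v' \<delta>' where v': "integrable \<nu> v'" "0 < \<delta>'"
    "\<And>x y. (\<And>i. i \<in> I \<Longrightarrow> dist (x i) (y i) < \<delta>') \<Longrightarrow> \<bar>v' x - v' y\<bar> \<le> \<epsilon> / 2"
    "(\<integral>x. \<bar>u' x - v' x\<bar> \<partial>\<nu>) \<le> \<epsilon> / 2" using uc_approximableE[OF ap(2) \<epsilon>] by blast
  have "\<bar>(v x + v' x) - (v y + v' y)\<bar> \<le> \<epsilon>" if "\<forall>i\<in>I. dist (x i) (y i) < min \<delta> \<delta>'" for x y
  proof -
    have "\<bar>v x - v y\<bar> \<le> \<epsilon> / 2" "\<bar>v' x - v' y\<bar> \<le> \<epsilon> / 2"
      using v(3)[of x y] v'(3)[of x y] that by auto
    thus ?thesis by linarith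
  qed
  moreover have "(\<integral>x. \<bar>(u x + u' x) - (v x + v' x)\<bar> \<partial>\<nu>)
      \<le> (\<integral>x. \<bar>u x - v x\<bar> + \<bar>u' x - v' x\<bar> \<partial>\<nu>)"
    using u v(1) v'(1) by (intro integral_mono) auto
  moreover have "\<dots> = (\<integral>x. \<bar>u x - v x\<bar> \<partial>\<nu>) + (\<integral>x. \<bar>u' x - v' x\<bar> \<partial>\<nu>)"
    using u v(1) v'(1) by (intro Bochner_Integration.integral_add) auto
  ultimately show "\<exists>v \<delta>. integrable \<nu> v \<and> 0 < \<delta> \<and>
      (\<forall>x y. (\<forall>i\<in>I. dist (x i) (y i) < \<delta>) \<longrightarrow> \<bar>v x - v y\<bar> \<le> \<epsilon>) \<and>
      (\<integral>x. \<bar>u x + u' x - v x\<bar> \<partial>\<nu>) \<le> \<epsilon>"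
    using v v' by (intro exI[of _ "\<lambda>x. v x + v' x"] exI[of _ "min \<delta> \<delta>'"]) auto
qed

lemma uc_approximable_mult:
  assumes ap: "uc_approximable I \<nu> u"
  shows "uc_approximable I \<nu> (\<lambda>x. c * u x)"
  unfolding uc_approximable_def
proof (intro allI impI)
  fix \<epsilon> :: real assume \<epsilon>: "0 < \<epsilon>"
  define \<epsilon>' where "\<epsilon>' = \<epsilon> / (\<bar>c\<bar> + 1)"
  have \<epsilon>': "0 < \<epsilon>'" "\<bar>c\<bar> * \<epsilon>' \<le> \<epsilon>" using \<epsilon> by (auto simp: \<epsilon>'_def field_simps)
  obtain v \<delta> where v: "integrable \<nu> v" "0 < \<delta>"
    "\<And>x y. (\<And>i. i \<in> I \<Longrightarrow> dist (x i) (y i) < \<delta>) \<Longrightarrow> \<bar>v x - v y\<bar> \<le> \<epsilon>'"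
    "(\<integral>x. \<bar>u x - v x\<bar> \<partial>\<nu>) \<le> \<epsilon>'" using uc_approximableE[OF ap \<epsilon>'(1)] by blast
  have le: "\<bar>c\<bar> * a \<le> \<epsilon>" if "a \<le> \<epsilon>'" for a
    using mult_left_mono[OF that, of "\<bar>c\<bar>"] \<epsilon>'(2) by auto
  have "\<bar>c * v x - c * v y\<bar> \<le> \<epsilon>" if "\<forall>i\<in>I. dist (x i) (y i) < \<delta>" for x y
    using le[OF v(3)[of x y]] that by (auto simp: abs_mult[symmetric] right_diff_distrib)
  moreover have "(\<integral>x. \<bar>c * u x - c * v x\<bar> \<partial>\<nu>) = \<bar>c\<bar> * (\<integral>x. \<bar>u x - v x\<bar> \<partial>\<nu>)"
    by (simp add: abs_mult flip: right_diff_distrib)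
  ultimately show "\<exists>v \<delta>. integrable \<nu> v \<and> 0 < \<delta> \<and>
      (\<forall>x y. (\<forall>i\<in>I. dist (x i) (y i) < \<delta>) \<longrightarrow> \<bar>v x - v y\<bar> \<le> \<epsilon>) \<and>
      (\<integral>x. \<bar>c * u x - v x\<bar> \<partial>\<nu>) \<le> \<epsilon>"
    using v le[OF v(4)] by (intro exI[of _ "\<lambda>x. c * v x"] exI[of _ \<delta>]) auto
qed

lemma uc_approximable_lim:
  fixes s :: "nat \<Rightarrow> ('i \<Rightarrow> 'm::metric_space) \<Rightarrow> real"
  assumes s: "\<And>n. integrable \<nu> (s n)" "\<And>n. uc_approximable I \<nu> (s n)"
    and u: "integrable \<nu> u"
    and lim: "(\<lambda>n. \<integral>x. \<bar>u x - s n x\<bar> \<partial>\<nu>) \<longlonglongrightarrow> 0"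
  shows "uc_approximable I \<nu> u"
  unfolding uc_approximable_def
proof (intro allI impI)
  fix \<epsilon> :: real assume "0 < \<epsilon>"
  hence \<epsilon>: "0 < \<epsilon> / 2" by simp
  obtain n where n: "(\<integral>x. \<bar>u x - s n x\<bar> \<partial>\<nu>) < \<epsilon> / 2"
    using order_tendstoD(2)[OF lim \<epsilon>] by (auto simp: eventually_sequentially)
  obtain v \<delta> where v: "integrable \<nu> v" "0 < \<delta>"
    "\<And>x y. (\<And>i. i \<in> I \<Longrightarrow> dist (x i) (y i) < \<delta>) \<Longrightarrow> \<bar>v x - v y\<bar> \<le> \<epsilon> / 2"
    "(\<integral>x. \<bar>s n x - v x\<bar> \<partial>\<nu>) \<le> \<epsilon> / 2" using uc_approximableE[OF s(2) \<epsilon>] by blast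
  have "(\<integral>x. \<bar>u x - v x\<bar> \<partial>\<nu>) \<le> (\<integral>x. \<bar>u x - s n x\<bar> + \<bar>s n x - v x\<bar> \<partial>\<nu>)"
    using u s(1)[of n] v(1) by (intro integral_mono) auto
  also have "\<dots> = (\<integral>x. \<bar>u x - s n x\<bar> \<partial>\<nu>) + (\<integral>x. \<bar>s n x - v x\<bar> \<partial>\<nu>)"
    using u s(1)[of n] v(1) by (intro Bochner_Integration.integral_add) auto
  finally have "(\<integral>x. \<bar>u x - v x\<bar> \<partial>\<nu>) \<le> \<epsilon>" using n v(4) by linarith
  moreover have "\<bar>v x - v y\<bar> \<le> \<epsilon>" if "\<forall>i\<in>I. dist (x i) (y i) < \<delta>" for x y
    using v(3)[of x y] that \<epsilon> by auto
  ultimately show "\<exists>v \<delta>. integrable \<nu> v \<and> 0 < \<delta> \<and>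
      (\<forall>x y. (\<forall>i\<in>I. dist (x i) (y i) < \<delta>) \<longrightarrow> \<bar>v x - v y\<bar> \<le> \<epsilon>) \<and>
      (\<integral>x. \<bar>u x - v x\<bar> \<partial>\<nu>) \<le> \<epsilon>"
    using v by blast
qed

lemma uc_approximable_lim_dominated:
  fixes s :: "nat \<Rightarrow> ('i \<Rightarrow> 'm::metric_space) \<Rightarrow> real"
  assumes s: "\<And>n. integrable \<nu> (s n)" "\<And>n. uc_approximable I \<nu> (s n)"
    and u: "integrable \<nu> u" and w: "integrable \<nu> w"
    and lim: "\<And>x. x \<in> space \<nu> \<Longrightarrow> (\<lambda>n. s n x) \<longlonglongrightarrow> u x"
    and bound: "\<And>n x. x \<in> space \<nu> \<Longrightarrow> \<bar>s n x\<bar> \<le> w x"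
  shows "uc_approximable I \<nu> u"
proof (rule uc_approximable_lim[OF s u])
  have "(\<lambda>n. \<integral>x. \<bar>u x - s n x\<bar> \<partial>\<nu>) \<longlonglongrightarrow> (\<integral>x. 0 \<partial>\<nu>)"
  proof (rule integral_dominated_convergence[where w = "\<lambda>x. \<bar>u x\<bar> + w x"])
    show "AE x in \<nu>. (\<lambda>n. \<bar>u x - s n x\<bar>) \<longlonglongrightarrow> 0"
    proof (rule AE_I2)
      fix x assume "x \<in> space \<nu>"
      hence "(\<lambda>n. \<bar>u x - s n x\<bar>) \<longlonglongrightarrow> \<bar>u x - u x\<bar>" by (intro tendsto_intros lim)
      thus "(\<lambda>n. \<bar>u x - s n x\<bar>) \<longlonglongrightarrow> 0" by simp
    qed
    show "AE x in \<nu>. norm \<bar>u x - s n x\<bar> \<le> \<bar>u x\<bar> + w x" for n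
    proof (rule AE_I2)
      fix x assume "x \<in> space \<nu>"
      from bound[OF this, of n] show "norm \<bar>u x - s n x\<bar> \<le> \<bar>u x\<bar> + w x" by auto
    qed
    show "(\<lambda>x. \<bar>u x - s n x\<bar>) \<in> borel_measurable \<nu>" for n
      using u s(1)[of n] by auto
  qed (use u w in auto)
  thus "(\<lambda>n. \<integral>x. \<bar>u x - s n x\<bar> \<partial>\<nu>) \<longlonglongrightarrow> 0" by simp
qed

text \<open>Closed rectangles are stable under intersection, as a Dynkin argument requires, and the
  distance to a closed side gives continuous approximations of the indicator.\<close>

lemma sets_PiM_borel_closed_rectangles:
  assumes "finite I"
  shows "sets (\<Pi>\<^sub>M i\<in>I. (borel :: 'm::topological_space measure))
    = sigma_sets (I \<rightarrow>\<^sub>E UNIV) {Pi\<^sub>E I F | F. \<forall>i\<in>I. closed (F i)}"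
proof -
  have "sets (\<Pi>\<^sub>M i\<in>I. sigma UNIV (Collect (closed :: 'm set \<Rightarrow> bool)))
    = sets (sigma (I \<rightarrow>\<^sub>E UNIV) {{f \<in> I \<rightarrow>\<^sub>E UNIV. \<forall>i\<in>j. f i \<in> A i} |A j. j \<in> {I} \<and> A \<in> Pi j (\<lambda>_. Collect closed)})"
    by (rule sets_PiM_sigma) (use assms in \<open>auto intro!: exI[of _ "{UNIV}"]\<close>)
  also have "{{f \<in> I \<rightarrow>\<^sub>E (UNIV :: 'm set). \<forall>i\<in>j. f i \<in> A i} |A j. j \<in> {I} \<and> A \<in> Pi j (\<lambda>_. Collect closed)}
    = {Pi\<^sub>E I F | F. \<forall>i\<in>I. closed (F i)}"
  proof -
    have "{f \<in> I \<rightarrow>\<^sub>E (UNIV :: 'm set). \<forall>i\<in>I. f i \<in> A i} = Pi\<^sub>E I A" for A by (auto simp: PiE_def)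
    thus ?thesis by (auto simp: Pi_def)
  qed
  also have "sets (sigma (I \<rightarrow>\<^sub>E UNIV) {Pi\<^sub>E I F | F. \<forall>i\<in>I. closed (F i :: 'm set)})
    = sigma_sets (I \<rightarrow>\<^sub>E UNIV) {Pi\<^sub>E I F | F. \<forall>i\<in>I. closed (F i)}"
    by (rule sets_measure_of) (auto simp: PiE_def)
  finally show ?thesis by (simp add: borel_eq_closed)
qed

section \<open>Approximation for finite Borel measures on finite products of metric spaces\<close>

locale finite_measure_PiM_borel = finite_measure \<nu>
  for \<nu> :: "('i \<Rightarrow> 'm::metric_space) measure" and I :: "'i set" +
  assumes finite_I: "finite I"
    and sets_nu: "sets \<nu> = sets (\<Pi>\<^sub>M i\<in>I. (borel :: 'm measure))"
begin

lemma space_nu: "space \<nu> = I \<rightarrow>\<^sub>E UNIV"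
  using sets_eq_imp_space_eq[OF sets_nu] by (simp add: space_PiM)

text \<open>The indicator is the pointwise limit of products of the tent functions max 0 (1 - n
  dist(x_i, F_i)). Each factor is n-Lipschitz with values in [0, 1], so the product is Lipschitz as
  well.\<close>

lemma uc_approximable_closed_rectangle:
  assumes F: "\<And>i. i \<in> I \<Longrightarrow> closed (F i)"
  shows "uc_approximable I \<nu> (indicator (Pi\<^sub>E I F))"
\<comment> \<open>\<open>infdist\<close> to the empty set is 0 by convention, so an empty side would
  make its tent function 1 instead of 0.\<close>
proof (cases "\<exists>i\<in>I. F i = {}")
  case True
  hence "Pi\<^sub>E I F = {}" by (simp add: PiE_eq_empty_iff)
  thus ?thesis using uc_approximable_const[of \<nu> I 0] finite_measure_axioms
    by (simp add: indicator_def[abs_def])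
next
  case False
  define h where "h n t = max 0 (1 - real n * t)" for n and t :: real
  define s where "s n x = (\<Prod>i\<in>I. h n (infdist (x i) (F i)))" for n and x :: "'i \<Rightarrow> 'm"
  have h: "0 \<le> h n t" "0 \<le> t \<Longrightarrow> h n t \<le> 1" for n t by (auto simp: h_def)
  have h_lip: "\<bar>h n t - h n t'\<bar> \<le> n * \<bar>t - t'\<bar>" for n t t'
  proof -
    have "\<bar>h n t - h n t'\<bar> \<le> \<bar>n * t - n * t'\<bar>" by (auto simp: h_def)
    thus ?thesis by (simp add: abs_mult flip: right_diff_distrib)
  qed
  have s_bound: "0 \<le> s n x" "s n x \<le> 1" for n x
    unfolding s_def using h by (auto intro!: prod_nonneg prod_le_1 infdist_nonneg)
  have [measurable]: "s n \<in> borel_measurable \<nu>" for n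
  proof -
    have "(\<lambda>x. h n (infdist (x i) (F i))) \<in> borel_measurable (\<Pi>\<^sub>M i\<in>I. borel)" if "i \<in> I" for i
    proof -
      have "(\<lambda>z. h n (infdist z (F i))) \<in> borel_measurable borel"
        unfolding h_def by (intro borel_measurable_continuous_onI continuous_intros)
      thus ?thesis using that by measurable
    qed
    hence "s n \<in> borel_measurable (\<Pi>\<^sub>M i\<in>I. borel)"
      unfolding s_def by (intro borel_measurable_prod)
    thus ?thesis by (simp cong: measurable_cong_sets add: sets_nu)
  qed
  have s_int: "integrable \<nu> (s n)" for n
    by (rule integrable_const_bound[of _ 1]) (use s_bound in auto)
  have s_lip: "\<bar>s n x - s n y\<bar> \<le> (\<Sum>i\<in>I. n * dist (x i) (y i))" for n x y
  proof -
    have "norm (s n x - s n y) \<le> (\<Sum>i\<in>I. norm (h n (infdist (x i) (F i)) - h n (infdist (y i) (F i))))"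
      unfolding s_def using h by (intro norm_prod_diff) (auto simp: infdist_nonneg)
    also have "\<dots> \<le> (\<Sum>i\<in>I. n * dist (x i) (y i))"
    proof (rule sum_mono)
      fix i
      have "n * \<bar>infdist (x i) (F i) - infdist (y i) (F i)\<bar> \<le> n * dist (x i) (y i)"
        by (intro mult_left_mono infdist_triangle_abs) auto
      thus "norm (h n (infdist (x i) (F i)) - h n (infdist (y i) (F i))) \<le> n * dist (x i) (y i)"
        using h_lip[of n "infdist (x i) (F i)" "infdist (y i) (F i)"] by simp
    qed
    finally show ?thesis by simp
  qed
  have s_approx: "uc_approximable I \<nu> (s n)" for n
    unfolding uc_approximable_def
  proof (intro allI impI)
    fix \<epsilon> :: real assume \<epsilon>: "0 < \<epsilon>"
    \<comment> \<open>The summand 1 keeps the denominator positive when n = 0 or I is empty.\<close>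
    define \<delta> where "\<delta> = \<epsilon> / (real (card I) * n + 1)"
    have \<delta>: "0 < \<delta>" "real (card I) * n * \<delta> \<le> \<epsilon>"
    proof -
      have "0 < real (card I) * n + 1" by (simp add: add_nonneg_pos)
      thus "0 < \<delta>" "real (card I) * n * \<delta> \<le> \<epsilon>" using \<epsilon> by (auto simp: \<delta>_def field_simps)
    qed
    have "\<bar>s n x - s n y\<bar> \<le> \<epsilon>" if "\<forall>i\<in>I. dist (x i) (y i) < \<delta>" for x y
    proof -
      have "(\<Sum>i\<in>I. n * dist (x i) (y i)) \<le> (\<Sum>i\<in>I. n * \<delta>)"
        using that by (intro sum_mono mult_left_mono) auto
      thus ?thesis using s_lip[of n x y] \<delta>(2) by simp
    qed
    thus "\<exists>v \<delta>. integrable \<nu> v \<and> 0 < \<delta> \<and>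
      (\<forall>x y. (\<forall>i\<in>I. dist (x i) (y i) < \<delta>) \<longrightarrow> \<bar>v x - v y\<bar> \<le> \<epsilon>) \<and> (\<integral>x. \<bar>s n x - v x\<bar> \<partial>\<nu>) \<le> \<epsilon>"
      using s_int \<delta>(1) \<epsilon> by (intro exI[of _ "s n"] exI[of _ \<delta>]) auto
  qed
  have rect: "Pi\<^sub>E I F \<in> sets \<nu>"
    unfolding sets_nu using F finite_I by (intro sets_PiM_I_finite) auto
  show ?thesis
  proof (rule uc_approximable_lim_dominated[where s = s and w = "\<lambda>_. 1"])
    fix x assume x: "x \<in> space \<nu>"
    show "(\<lambda>n. s n x) \<longlonglongrightarrow> indicator (Pi\<^sub>E I F) x"
    proof (cases "x \<in> Pi\<^sub>E I F")
      case True
      hence "s n x = 1" for n by (auto simp: s_def h_def PiE_iff)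
      thus ?thesis using True by simp
    next
      case out: False
      then obtain i where i: "i \<in> I" "x i \<notin> F i" using x by (auto simp: PiE_iff space_nu)
      hence d: "0 < infdist (x i) (F i)"
        using in_closed_iff_infdist_zero[OF F, of i "x i"] False infdist_nonneg[of "x i" "F i"] by force
      obtain n0 where n0: "1 < real n0 * infdist (x i) (F i)"
        using reals_Archimedean3[OF d] by blast
      have "s n x = 0" if "n \<ge> n0" for n
      proof -
        have "real n0 * infdist (x i) (F i) \<le> n * infdist (x i) (F i)"
          using that d by (intro mult_right_mono) auto
        hence "h n (infdist (x i) (F i)) = 0" using n0 by (auto simp: h_def)
        thus ?thesis unfolding s_def using finite_I i by (intro prod_zero) auto
      qed
      hence "eventually (\<lambda>n. s n x = 0) sequentially" by (auto simp: eventually_sequentially)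
      thus ?thesis using out by (auto intro: tendsto_eventually)
    qed
  next
    show "integrable \<nu> (indicator (Pi\<^sub>E I F) :: _ \<Rightarrow> real)"
      using rect by (simp add: emeasure_eq_measure)
  qed (use s_int s_approx s_bound in auto)
qed

text \<open>Dynkin's theorem: complements are handled by 1 - indicator, disjoint unions by partial
  sums, which are dominated by 1.\<close>

lemma uc_approximable_indicator:
  assumes "A \<in> sets \<nu>"
  shows "uc_approximable I \<nu> (indicator A)"
proof -
  let ?G = "{Pi\<^sub>E I F | F. \<forall>i\<in>I. closed (F i :: 'm set)}"
  have gen: "sets \<nu> = sigma_sets (space \<nu>) ?G"
    by (simp add: sets_nu space_nu sets_PiM_borel_closed_rectangles[OF finite_I])
  have "Int_stable ?G"
    unfolding Int_stable_def
  proof safe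
    fix F F' :: "'i \<Rightarrow> 'm set" assume "\<forall>i\<in>I. closed (F i)" "\<forall>i\<in>I. closed (F' i)"
    thus "\<exists>F''. Pi\<^sub>E I F \<inter> Pi\<^sub>E I F' = Pi\<^sub>E I F'' \<and> (\<forall>i\<in>I. closed (F'' i))"
      by (intro exI[of _ "\<lambda>i. F i \<inter> F' i"]) (auto simp: PiE_Int)
  qed
  moreover have "?G \<subseteq> Pow (space \<nu>)" by (auto simp: space_nu PiE_def)
  moreover have "A \<in> sigma_sets (space \<nu>) ?G" using assms gen by simp
  ultimately show ?thesis
  proof (induction rule: sigma_sets_induct_disjoint)
    case (basic A)
    thus ?case using uc_approximable_closed_rectangle by auto
  next
    case empty
    show ?case using uc_approximable_const[of \<nu> I 0] finite_measure_axioms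
      by (simp add: indicator_def[abs_def])
  next
    case (compl A)
    have "integrable \<nu> (indicator A :: _ \<Rightarrow> real)"
      using compl(1) gen by (simp add: emeasure_eq_measure)
    hence "uc_approximable I \<nu> (\<lambda>x. 1 + (-1) * indicator A x)"
      using compl finite_measure_axioms
      by (intro uc_approximable_add uc_approximable_mult uc_approximable_const) auto
    moreover have "1 + (-1) * indicator A x = (indicator (space \<nu> - A) x :: real)" if "x \<in> space \<nu>" for x
      using that by (auto simp: indicator_def)
    ultimately show ?case by (subst (asm) uc_approximable_cong) auto
  next
    case (union A)
    have A: "A n \<in> sets \<nu>" for n using union(2) gen by auto
    have int: "integrable \<nu> (indicator (A n) :: _ \<Rightarrow> real)" for n
      using A by (simp add: emeasure_eq_measure)
    show ?case
    proof (rule uc_approximable_lim_dominated[where s = "\<lambda>n x. \<Sum>j<n. indicator (A j) x" and w = "\<lambda>_. 1"])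
      show "uc_approximable I \<nu> (\<lambda>x. \<Sum>j<n. indicator (A j) x)" for n
      proof (induction n)
        case 0
        show ?case using uc_approximable_const[of \<nu> I 0] finite_measure_axioms by simp
      next
        case (Suc n)
        show ?case unfolding sum.lessThan_Suc
          by (intro uc_approximable_add Bochner_Integration.integrable_sum int Suc union.IH)
      qed
      have sums: "(\<lambda>j. indicator (A j) x) sums (indicator (\<Union>i. A i) x :: real)" for x
        by (rule indicator_sums) (use union(1) in \<open>auto simp: disjoint_family_on_def\<close>)
      show "(\<lambda>n. \<Sum>j<n. indicator (A j) x) \<longlonglongrightarrow> (indicator (\<Union>i. A i) x :: real)" for x
        using sums[of x] by (simp add: sums_def)
      show "\<bar>\<Sum>j<n. indicator (A j) x :: real\<bar> \<le> 1" for n x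
      proof -
        have "(\<Sum>j<n. indicator (A j) x :: real) \<le> indicator (\<Union>i. A i) x"
          using sum_le_suminf[of "\<lambda>j. indicator (A j) x :: real" "{..<n}"] sums[of x]
          by (auto simp: sums_iff)
        also have "\<dots> \<le> 1" by (simp add: indicator_def)
        finally show ?thesis by (simp add: sum_nonneg)
      qed
    qed (use int A in \<open>auto simp: emeasure_eq_measure\<close>)
  qed
qed

proposition uc_approximable_integrable:
  fixes u :: "('i \<Rightarrow> 'm) \<Rightarrow> real"
  assumes "integrable \<nu> u"
  shows "uc_approximable I \<nu> u"
  using assms
proof (induction rule: integrable_induct)
  case (base A c)
  have "uc_approximable I \<nu> (\<lambda>x. c * indicator A x)"
    using base by (intro uc_approximable_mult uc_approximable_indicator)
  thus ?case by (simp add: mult.commute)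
next
  case (add f g)
  thus ?case by (intro uc_approximable_add)
next
  case (lim f s)
  show ?case
    \<comment> \<open>The induction rule supplies simple functions bounded by twice the norm of
      their limit.\<close>
    by (rule uc_approximable_lim_dominated[where s = s and w = "\<lambda>x. 2 * \<bar>f x\<bar>"])
      (use lim in auto)
qed

end

section \<open>Total variation distance of product measures\<close>

text \<open>Test functions with values in [0, 1] rather than events: integrating out one coordinate
  of an indicator leaves such a function, which makes induction over the factors of a product
  possible.\<close>

definition tv_close :: "'a measure \<Rightarrow> 'a measure \<Rightarrow> real \<Rightarrow> bool" where
  "tv_close M N \<delta> \<longleftrightarrow> sets M = sets N \<and>
     (\<forall>h\<in>borel_measurable M. (\<forall>x. 0 \<le> h x \<and> h x \<le> (1::real)) \<longrightarrow> \<bar>(\<integral>x. h x \<partial>M) - (\<integral>x. h x \<partial>N)\<bar> \<le> \<delta>)"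

lemma tv_closeD:
  assumes "tv_close M N \<delta>" "h \<in> borel_measurable M" "\<And>x. 0 \<le> h x" "\<And>x. h x \<le> (1::real)"
  shows "\<bar>(\<integral>x. h x \<partial>M) - (\<integral>x. h x \<partial>N)\<bar> \<le> \<delta>"
  using assms by (auto simp: tv_close_def)

lemma tv_close_measure:
  assumes "tv_close M N \<delta>" "B \<in> sets M"
  shows "\<bar>measure M B - measure N B\<bar> \<le> \<delta>"
proof -
  have "\<bar>(\<integral>x. indicator B x \<partial>M) - (\<integral>x. indicator B x \<partial>N)\<bar> \<le> \<delta>"
    using assms by (intro tv_closeD[OF assms(1)]) auto
  moreover have "B \<in> sets N" using assms by (simp add: tv_close_def)
  ultimately show ?thesis using assms(2) by simp
qed

text \<open>Without integrability the integral is 0 by convention, so the bound still holds.\<close>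

lemma integral_prob_le_1:
  assumes "prob_space M" "\<And>x. h x \<le> (1::real)"
  shows "(\<integral>x. h x \<partial>M) \<le> 1"
proof (cases "integrable M h")
  case True
  thus ?thesis using assms by (intro prob_space.integral_le_const) auto
qed (simp add: not_integrable_integral_eq)

text \<open>Factors are exchanged one at a time. After the new coordinate is integrated out, the
  error splits into one on the remaining factors, covered by the induction hypothesis, and one on
  the new factor; the errors add up.\<close>

lemma tv_close_PiM:
  fixes M N :: "'i \<Rightarrow> 'b measure"
  assumes "finite I" and M: "\<And>i. prob_space (M i)" and N: "\<And>i. prob_space (N i)"
    and close: "\<And>i. i \<in> I \<Longrightarrow> tv_close (M i) (N i) (\<delta> i)"
  shows "tv_close (Pi\<^sub>M I M) (Pi\<^sub>M I N) (\<Sum>i\<in>I. \<delta> i)"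
  using assms(1) close
proof (induction I)
  case empty
  have "Pi\<^sub>M {} M = Pi\<^sub>M {} N" by (rule PiM_cong) auto
  thus ?case by (simp add: tv_close_def)
next
  case (insert i I)
  interpret M: product_prob_space M using M by (rule product_prob_spaceI)
  interpret N: product_prob_space N using N by (rule product_prob_spaceI)
  interpret PM: prob_space "Pi\<^sub>M I M" by (rule prob_space_PiM) (rule M)
  interpret PN: prob_space "Pi\<^sub>M I N" by (rule prob_space_PiM) (rule N)
  interpret PMi: prob_space "Pi\<^sub>M (insert i I) M" by (rule prob_space_PiM) (rule M)
  interpret PNi: prob_space "Pi\<^sub>M (insert i I) N" by (rule prob_space_PiM) (rule N)
  have sets_eq: "\<And>j. j \<in> insert i I \<Longrightarrow> sets (M j) = sets (N j)"
    using insert.prems by (auto simp: tv_close_def)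
  have sets_PiM: "sets (Pi\<^sub>M I M) = sets (Pi\<^sub>M I N)"
    and sets_PiM': "sets (Pi\<^sub>M (insert i I) M) = sets (Pi\<^sub>M (insert i I) N)"
    using sets_eq by (auto intro!: sets_PiM_cong)
  note sets_eq_i = sets_eq[of i, simplified]
  show ?case
    unfolding tv_close_def
  proof (intro conjI ballI impI sets_PiM')
    fix h :: "('i \<Rightarrow> 'b) \<Rightarrow> real"
    assume h [measurable]: "h \<in> borel_measurable (Pi\<^sub>M (insert i I) M)"
      and h01: "\<forall>x. 0 \<le> h x \<and> h x \<le> 1"
    have hN [measurable]: "h \<in> borel_measurable (Pi\<^sub>M (insert i I) N)"
      using h sets_PiM' by (simp cong: measurable_cong_sets)
    \<comment> \<open>The inner integrals against the two versions of the new factor.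
      \<open>HM\<close> is the test function to which the induction hypothesis is applied.\<close>
    define HM where "HM x = (\<integral>y. h (x(i := y)) \<partial>M i)" for x
    define HN where "HN x = (\<integral>y. h (x(i := y)) \<partial>N i)" for x
    have "(\<lambda>(x, y). h (x(i := y))) \<in> borel_measurable (Pi\<^sub>M I M \<Otimes>\<^sub>M M i)"
      using measurable_compose[OF measurable_add_dim h] by (simp add: case_prod_unfold)
    hence HM_meas [measurable]: "HM \<in> borel_measurable (Pi\<^sub>M I M)"
      unfolding HM_def by (rule M.M.borel_measurable_lebesgue_integral)
    have "(\<lambda>(x, y). h (x(i := y))) \<in> borel_measurable (Pi\<^sub>M I N \<Otimes>\<^sub>M N i)"
      using measurable_compose[OF measurable_add_dim hN] by (simp add: case_prod_unfold)
    hence HN_meas [measurable]: "HN \<in> borel_measurable (Pi\<^sub>M I N)"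
      unfolding HN_def by (rule N.M.borel_measurable_lebesgue_integral)
    have HM_meas' [measurable]: "HM \<in> borel_measurable (Pi\<^sub>M I N)"
      using HM_meas sets_PiM by (simp cong: measurable_cong_sets)
    have bounds: "0 \<le> HM x" "HM x \<le> 1" "0 \<le> HN x" "HN x \<le> 1" for x
      unfolding HM_def HN_def using h01 M N
      by (auto intro!: Bochner_Integration.integral_nonneg integral_prob_le_1)
    have diff: "\<bar>HM x - HN x\<bar> \<le> \<delta> i" if x: "x \<in> space (Pi\<^sub>M I N)" for x
    proof -
      have "x \<in> space (Pi\<^sub>M I M)" using x sets_eq_imp_space_eq[OF sets_PiM] by simp
      hence "(\<lambda>y. x(i := y)) \<in> M i \<rightarrow>\<^sub>M Pi\<^sub>M (insert i I) M"
        using measurable_compose[OF measurable_Pair1' measurable_add_dim[of i I M]] by simp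
      hence "(\<lambda>y. h (x(i := y))) \<in> borel_measurable (M i)"
        by (rule measurable_compose[OF _ h])
      thus ?thesis
        unfolding HM_def HN_def using h01 insert.prems[of i] by (intro tv_closeD) auto
    qed
    have intM: "(\<integral>x. h x \<partial>Pi\<^sub>M (insert i I) M) = (\<integral>x. HM x \<partial>Pi\<^sub>M I M)"
      unfolding HM_def using insert.hyps h01
      by (intro M.product_integral_insert) (auto intro!: PMi.integrable_const_bound[of _ 1])
    have intN: "(\<integral>x. h x \<partial>Pi\<^sub>M (insert i I) N) = (\<integral>x. HN x \<partial>Pi\<^sub>M I N)"
      unfolding HN_def using insert.hyps h01
      by (intro N.product_integral_insert) (auto intro!: PNi.integrable_const_bound[of _ 1])
    have int: "integrable (Pi\<^sub>M I N) HM" "integrable (Pi\<^sub>M I N) HN"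
      using bounds by (auto intro!: PN.integrable_const_bound[of _ 1])
    have "tv_close (Pi\<^sub>M I M) (Pi\<^sub>M I N) (\<Sum>j\<in>I. \<delta> j)"
      using insert.IH insert.prems by auto
    hence "\<bar>(\<integral>x. HM x \<partial>Pi\<^sub>M I M) - (\<integral>x. HM x \<partial>Pi\<^sub>M I N)\<bar> \<le> (\<Sum>j\<in>I. \<delta> j)"
      using bounds by (intro tv_closeD) auto
    moreover have "\<bar>(\<integral>x. HM x \<partial>Pi\<^sub>M I N) - (\<integral>x. HN x \<partial>Pi\<^sub>M I N)\<bar> \<le> \<delta> i"
    proof -
      have "\<bar>(\<integral>x. HM x \<partial>Pi\<^sub>M I N) - (\<integral>x. HN x \<partial>Pi\<^sub>M I N)\<bar> = \<bar>\<integral>x. HM x - HN x \<partial>Pi\<^sub>M I N\<bar>"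
        using int by simp
      also have "\<dots> \<le> (\<integral>x. \<bar>HM x - HN x\<bar> \<partial>Pi\<^sub>M I N)" by (rule integral_abs_bound)
      also have "\<dots> \<le> \<delta> i"
        using int diff by (intro PN.integral_le_const AE_I2) auto
      finally show ?thesis .
    qed
    ultimately show "\<bar>(\<integral>x. h x \<partial>Pi\<^sub>M (insert i I) M) - (\<integral>x. h x \<partial>Pi\<^sub>M (insert i I) N)\<bar>
        \<le> (\<Sum>j\<in>insert i I. \<delta> j)"
      using insert.hyps intM intN by simp
  qed
qed

section \<open>Rotations of the torus\<close>

text \<open>A measure on the whole plane, concentrated on the unit circle. For this reason
  identities that need modulus 1 hold only almost everywhere under \<open>haar p\<close>.\<close>

definition circle :: "complex measure" where
  "circle = distr (restrict_space lborel {0..<1}) borel (\<lambda>\<theta>. cis (2 * pi * \<theta>))"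

lemma measurable_cis [measurable]: "cis \<in> borel_measurable borel"
  by (intro borel_measurable_continuous_onI continuous_intros)

lemma prob_space_unit_interval: "prob_space (restrict_space lborel {0..<1::real})"
  by (rule prob_spaceI) (simp add: emeasure_restrict_space space_restrict_space)

lemma measurable_unit_interval_cis:
  "(\<lambda>\<theta>. cis (2 * pi * \<theta>)) \<in> borel_measurable (restrict_space lborel {0..<1::real})"
  by (rule measurable_restrict_space1) measurable

lemma prob_space_circle: "prob_space circle"
  unfolding circle_def
  by (rule prob_space.prob_space_distr[OF prob_space_unit_interval measurable_unit_interval_cis])

lemma sets_circle [simp, measurable_cong]: "sets circle = sets borel"
  by (simp add: circle_def)

lemma space_circle [simp]: "space circle = UNIV"
  by (simp add: circle_def)

lemma nn_integral_circle:
  assumes [measurable]: "g \<in> borel_measurable borel"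
  shows "(\<integral>\<^sup>+z. g z \<partial>circle) = (\<integral>\<^sup>+\<theta>. g (cis (2 * pi * \<theta>)) * indicator {0..<1} \<theta> \<partial>lborel)"
  unfolding circle_def
  by (simp add: nn_integral_distr measurable_unit_interval_cis nn_integral_restrict_space)

text \<open>The translated period [t, 1 + t) is cut at 1, and its second piece is moved back by one
  period onto [0, t).\<close>

lemma nn_integral_period_shift:
  fixes g :: "real \<Rightarrow> ennreal"
  assumes [measurable]: "g \<in> borel_measurable borel" and per: "\<And>\<theta>. g (\<theta> + 1) = g \<theta>"
    and t: "0 \<le> t" "t < 1"
  shows "(\<integral>\<^sup>+\<theta>. g (\<theta> + t) * indicator {0..<1} \<theta> \<partial>lborel) = (\<integral>\<^sup>+\<theta>. g \<theta> * indicator {0..<1} \<theta> \<partial>lborel)"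
proof -
  have shift: "(\<integral>\<^sup>+\<theta>. f \<theta> \<partial>lborel) = (\<integral>\<^sup>+\<theta>. f (\<theta> + c) \<partial>lborel)"
    if [measurable]: "f \<in> borel_measurable borel" for f :: "real \<Rightarrow> ennreal" and c
    using nn_integral_real_affine[OF that, of 1 c] by (simp add: add.commute)
  have "(\<integral>\<^sup>+\<theta>. g (\<theta> + t) * indicator {0..<1} \<theta> \<partial>lborel)
      = (\<integral>\<^sup>+\<theta>. g \<theta> * indicator {0..<1} (\<theta> - t) \<partial>lborel)"
    by (subst shift[of "\<lambda>\<theta>. g \<theta> * indicator {0..<1} (\<theta> - t)" t]) simp_all
  also have "\<dots> = (\<integral>\<^sup>+\<theta>. g \<theta> * indicator {t..<1} \<theta> + g \<theta> * indicator {1..<1 + t} \<theta> \<partial>lborel)"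
    using t by (intro nn_integral_cong) (auto simp: indicator_def)
  also have "\<dots> = (\<integral>\<^sup>+\<theta>. g \<theta> * indicator {t..<1} \<theta> \<partial>lborel) + (\<integral>\<^sup>+\<theta>. g \<theta> * indicator {1..<1 + t} \<theta> \<partial>lborel)"
    by (rule nn_integral_add) measurable
  also have "(\<integral>\<^sup>+\<theta>. g \<theta> * indicator {1..<1 + t} \<theta> \<partial>lborel) = (\<integral>\<^sup>+\<theta>. g \<theta> * indicator {0..<t} \<theta> \<partial>lborel)"
    by (subst shift[of _ 1]) (auto simp: per indicator_def intro!: nn_integral_cong)
  also have "(\<integral>\<^sup>+\<theta>. g \<theta> * indicator {t..<1} \<theta> \<partial>lborel) + \<dots>
      = (\<integral>\<^sup>+\<theta>. g \<theta> * indicator {t..<1} \<theta> + g \<theta> * indicator {0..<t} \<theta> \<partial>lborel)"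
    by (rule nn_integral_add[symmetric]) measurable
  also have "\<dots> = (\<integral>\<^sup>+\<theta>. g \<theta> * indicator {0..<1} \<theta> \<partial>lborel)"
    using t by (intro nn_integral_cong) (auto simp: indicator_def)
  finally show ?thesis .
qed

lemma cis_2pi_frac: "cis (2 * pi * frac t) = cis (2 * pi * t)"
proof -
  have "cis (2 * pi * t) = cis (2 * pi * frac t + 2 * pi * of_int \<lfloor>t\<rfloor>)"
    by (simp add: frac_def algebra_simps)
  also have "\<dots> = cis (2 * pi * frac t) * cis (2 * pi * of_int \<lfloor>t\<rfloor>)"
    by (rule cis_mult[symmetric])
  finally show ?thesis by (simp add: cis_multiple_2pi)
qed

text \<open>A rotation depends on t only modulo 1, so t may be replaced by its fractional
  part.\<close>

lemma circle_rotate: "distr circle borel (\<lambda>z. z * cis (2 * pi * t)) = circle"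
proof (rule measure_eqI)
  fix B assume "B \<in> sets (distr circle borel (\<lambda>z. z * cis (2 * pi * t)))"
  hence B [measurable]: "B \<in> sets borel" by simp
  define g where "g \<theta> = (indicator B (cis (2 * pi * \<theta>)) :: ennreal)" for \<theta>
  have [measurable]: "g \<in> borel_measurable borel" unfolding g_def by measurable
  have per: "g (\<theta> + 1) = g \<theta>" for \<theta>
    by (simp add: g_def distrib_left cis_mult[symmetric])
  have "emeasure (distr circle borel (\<lambda>z. z * cis (2 * pi * t))) B
      = (\<integral>\<^sup>+z. indicator B (z * cis (2 * pi * t)) \<partial>circle)"
    by (subst nn_integral_indicator[symmetric], simp, subst nn_integral_distr) auto
  also have "\<dots> = (\<integral>\<^sup>+\<theta>. g (\<theta> + frac t) * indicator {0..<1} \<theta> \<partial>lborel)"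
    by (subst nn_integral_circle) (auto simp: g_def distrib_left cis_mult[symmetric] cis_2pi_frac)
  also have "\<dots> = (\<integral>\<^sup>+\<theta>. g \<theta> * indicator {0..<1} \<theta> \<partial>lborel)"
    by (rule nn_integral_period_shift) (auto simp: per frac_lt_1)
  also have "\<dots> = (\<integral>\<^sup>+z. indicator B z \<partial>circle)"
    by (subst nn_integral_circle) (auto simp: g_def)
  also have "\<dots> = emeasure circle B" by simp
  finally show "emeasure (distr circle borel (\<lambda>z. z * cis (2 * pi * t))) B = emeasure circle B" .
qed simp

lemma AE_circle: "AE z in circle. cmod z = 1"
  unfolding circle_def
  by (subst AE_distr_iff[OF measurable_unit_interval_cis]) auto

text \<open>Coordinates are independent under a product measure, so functions of single coordinates
  are too, and their joint law is the product of their laws. That characterisation of independence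
  wants a nonempty index set, hence the case split.\<close>

lemma distr_PiM_componentwise:
  assumes "finite I" and M: "\<And>i. i \<in> I \<Longrightarrow> prob_space (M i)"
    and f: "\<And>i. i \<in> I \<Longrightarrow> f i \<in> M i \<rightarrow>\<^sub>M M' i"
  shows "distr (Pi\<^sub>M I M) (Pi\<^sub>M I M') (\<lambda>x. \<lambda>i\<in>I. f i (x i)) = Pi\<^sub>M I (\<lambda>i. distr (M i) (M' i) (f i))"
proof (cases "I = {}")
  case True
  show ?thesis
    unfolding True PiM_empty
    by (rule measure_eqI) (auto simp: restrict_def emeasure_distr subset_singleton_iff)
next
  case False
  interpret prob_space "Pi\<^sub>M I M" by (rule prob_space_PiM) (rule M)
  have comp: "(\<lambda>x. f i (x i)) \<in> Pi\<^sub>M I M \<rightarrow>\<^sub>M M' i" if "i \<in> I" for i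
    by (rule measurable_compose[OF _ f[OF that]]) (rule measurable_component_singleton[OF that])
  have "indep_vars M (\<lambda>i x. x i) I"
  proof (subst indep_vars_iff_distr_eq_PiM'[OF False])
    show "distr (Pi\<^sub>M I M) (Pi\<^sub>M I M) (\<lambda>x. \<lambda>i\<in>I. x i) = Pi\<^sub>M I (\<lambda>i. distr (Pi\<^sub>M I M) (M i) (\<lambda>x. x i))"
    proof -
      have "distr (Pi\<^sub>M I M) (Pi\<^sub>M I M) (\<lambda>x. \<lambda>i\<in>I. x i) = distr (Pi\<^sub>M I M) (Pi\<^sub>M I M) (\<lambda>x. x)"
        by (intro distr_cong) (auto simp: space_PiM PiE_def extensional_restrict)
      also have "\<dots> = Pi\<^sub>M I (\<lambda>i. distr (Pi\<^sub>M I M) (M i) (\<lambda>x. x i))"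
        using M by (auto intro!: PiM_cong simp: distr_PiM_component)
      finally show ?thesis .
    qed
  qed auto
  hence "indep_vars M' (\<lambda>i x. f i (x i)) I"
    by (rule indep_vars_compose2) (rule f)
  hence "distr (Pi\<^sub>M I M) (Pi\<^sub>M I M') (\<lambda>x. \<lambda>i\<in>I. f i (x i))
      = Pi\<^sub>M I (\<lambda>i. distr (Pi\<^sub>M I M) (M' i) (\<lambda>x. f i (x i)))"
    using comp by (subst (asm) indep_vars_iff_distr_eq_PiM'[OF False]) auto
  also have "\<dots> = Pi\<^sub>M I (\<lambda>i. distr (M i) (M' i) (f i))"
  proof (rule PiM_cong[OF refl])
    fix i assume i: "i \<in> I"
    have "distr (Pi\<^sub>M I M) (M' i) (\<lambda>x. f i (x i)) = distr (distr (Pi\<^sub>M I M) (M i) (\<lambda>x. x i)) (M' i) (f i)"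
      using i f by (subst distr_distr) (auto simp: comp_def)
    thus "distr (Pi\<^sub>M I M) (M' i) (\<lambda>x. f i (x i)) = distr (M i) (M' i) (f i)"
      using i M by (simp add: distr_PiM_component)
  qed
  finally show ?thesis .
qed

lemma haar_eq_PiM: "haar p = (\<Pi>\<^sub>M i\<in>{..<p}. circle)"
  unfolding haar_def circle_def
  using distr_PiM_componentwise[of "{..<p}" "\<lambda>_. restrict_space lborel {0..<1}"
      "\<lambda>_ \<theta>. cis (2 * pi * \<theta>)" "\<lambda>_. borel"]
  by (simp add: prob_space_unit_interval measurable_unit_interval_cis)

lemma prob_space_haar: "prob_space (haar p)"
  unfolding haar_eq_PiM by (rule prob_space_PiM) (rule prob_space_circle)

lemma sets_haar [measurable_cong]: "sets (haar p) = sets (\<Pi>\<^sub>M i\<in>{..<p}. borel)"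
  by (simp add: haar_def)

lemma space_haar: "space (haar p) = ({..<p} \<rightarrow>\<^sub>E UNIV)"
  by (simp add: haar_def space_PiM)

lemma AE_haar_torus: "AE x in haar p. x \<in> torus p"
proof -
  have "AE x in haar p. \<forall>i\<in>{..<p}. cmod (x i) = 1"
    unfolding haar_eq_PiM
    by (intro AE_finite_allI) (auto intro!: AE_PiM_component prob_space_circle AE_circle)
  moreover have "AE x in haar p. x \<in> space (haar p)" by (rule AE_space)
  ultimately show ?thesis
    by eventually_elim (auto simp: torus_def space_haar PiE_iff)
qed

text \<open>Angles are measured in full turns, so translation by a grid vector v is rotation by v_i
  / k_i.\<close>

definition rotation :: "nat \<Rightarrow> (nat \<Rightarrow> real) \<Rightarrow> (nat \<Rightarrow> complex) \<Rightarrow> nat \<Rightarrow> complex" where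
  "rotation p t x = (\<lambda>i\<in>{..<p}. x i * cis (2 * pi * t i))"

lemma measurable_rotate [measurable]: "rotation p t \<in> haar p \<rightarrow>\<^sub>M haar p"
  unfolding rotation_def[abs_def] by measurable

lemma haar_rotate: "distr (haar p) (haar p) (rotation p t) = haar p"
proof -
  have "distr (haar p) (haar p) (rotation p t)
      = distr (\<Pi>\<^sub>M i\<in>{..<p}. circle) (\<Pi>\<^sub>M i\<in>{..<p}. borel) (\<lambda>x. \<lambda>i\<in>{..<p}. x i * cis (2 * pi * t i))"
    unfolding rotation_def[abs_def] haar_eq_PiM by (intro distr_cong sets_PiM_cong) auto
  also have "\<dots> = (\<Pi>\<^sub>M i\<in>{..<p}. distr circle borel (\<lambda>z. z * cis (2 * pi * t i)))"
    by (intro distr_PiM_componentwise) (auto intro: prob_space_circle)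
  also have "\<dots> = haar p" by (simp add: circle_rotate haar_eq_PiM)
  finally show ?thesis .
qed

lemma dist_cis_one_le: "dist (cis a) 1 \<le> \<bar>a\<bar>"
proof -
  have "cmod (iexp a - 1) \<le> \<bar>a\<bar>" using iexp_approx1[of a 0] by simp
  thus ?thesis by (simp add: dist_norm cis_conv_exp)
qed

section \<open>Cyclic grids on the torus\<close>

text \<open>The inverse of the parametrisation of the circle by [0, 1); \<open>frac\<close> folds
  the range of the principal argument into that interval.\<close>

definition turn :: "complex \<Rightarrow> real" where
  "turn z = frac (Im (Ln z) / (2 * pi))"

lemma measurable_turn [measurable]: "turn \<in> borel_measurable borel"
  unfolding turn_def frac_def by measurable

lemma turn_nonneg: "0 \<le> turn z" and turn_less_1: "turn z < 1"
  by (auto simp: turn_def frac_lt_1)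

lemma turn_cis: "turn (cis (2 * pi * t)) = frac t"
proof -
  have "exp (Ln (cis (2 * pi * t))) = exp (\<i> * of_real (2 * pi * t))"
    by (simp add: cis_conv_exp)
  then obtain n :: int where "Ln (cis (2 * pi * t)) = \<i> * of_real (2 * pi * t) + (of_int (2 * n) * pi) * \<i>"
    unfolding exp_eq by auto
  hence "Im (Ln (cis (2 * pi * t))) = 2 * pi * t + 2 * n * pi" by simp
  hence "Im (Ln (cis (2 * pi * t))) / (2 * pi) = t + of_int n" by (simp add: field_simps)
  thus ?thesis by (simp add: turn_def frac_def)
qed

lemma cis_turn: "cmod z = 1 \<Longrightarrow> cis (2 * pi * turn z) = z"
proof -
  assume z: "cmod z = 1"
  hence "Re (Ln z) = 0" by (subst Re_Ln) auto
  hence "Ln z = \<i> * of_real (Im (Ln z))" by (auto simp: complex_eq_iff)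
  hence "cis (Im (Ln z)) = z"
    using z by (metis cis_conv_exp exp_Ln norm_zero zero_neq_one)
  thus ?thesis by (simp add: turn_def cis_2pi_frac)
qed

lemma turn_mult_cis: "cmod z = 1 \<Longrightarrow> turn (z * cis (2 * pi * t)) = frac (turn z + t)"
  using cis_turn[of z] turn_cis[of "turn z + t"] by (simp add: distrib_left flip: cis_mult)

lemma torus_lincomb_turn:
  assumes "\<And>j. j < m \<Longrightarrow> x j \<in> torus p" "i < p"
  shows "torus_lincomb p m c x i = cis (2 * pi * (\<Sum>j<m. c j * turn (x j i)))"
proof -
  have "torus_lincomb p m c x i = (\<Prod>j<m. cis (2 * pi * (c j * turn (x j i))))"
  proof -
    have "x j i powi c j = cis (2 * pi * (c j * turn (x j i)))" if "j < m" for j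
    proof -
      have "cmod (x j i) = 1" using assms that by (auto simp: torus_def PiE_iff)
      hence "x j i powi c j = cis (2 * pi * turn (x j i)) powi c j" by (simp add: cis_turn)
      also have "\<dots> = cis (2 * pi * (c j * turn (x j i)))" by (simp add: cis_power_int mult_ac)
      finally show ?thesis .
    qed
    thus ?thesis using assms(2) by (simp add: torus_lincomb_def)
  qed
  also have "\<dots> = cis (\<Sum>j<m. 2 * pi * (c j * turn (x j i)))"
    by (induction m) (simp_all add: cis_mult)
  finally show ?thesis by (simp add: sum_distrib_left)
qed

lemma turn_torus_lincomb:
  assumes "\<And>j. j < m \<Longrightarrow> x j \<in> torus p" "i < p"
  shows "turn (torus_lincomb p m c x i) = frac (\<Sum>j<m. c j * turn (x j i))"
  by (simp add: torus_lincomb_turn[OF assms] turn_cis)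

lemma floor_nat_mult_frac: "\<exists>d::int. \<lfloor>real k * frac t\<rfloor> = \<lfloor>real k * t\<rfloor> - int k * d"
proof (intro exI)
  have "real k * frac t = real k * t - of_int (int k * \<lfloor>t\<rfloor>)" by (simp add: frac_def algebra_simps)
  thus "\<lfloor>real k * frac t\<rfloor> = \<lfloor>real k * t\<rfloor> - int k * \<lfloor>t\<rfloor>" by (simp only: floor_diff_of_int)
qed

lemma floor_nat_mult_frac_mod: "\<lfloor>real k * frac t\<rfloor> mod int k = \<lfloor>real k * t\<rfloor> mod int k"
proof -
  obtain d :: int where d: "\<lfloor>real k * frac t\<rfloor> = \<lfloor>real k * t\<rfloor> - int k * d"
    using floor_nat_mult_frac by blast
  show ?thesis unfolding d by (metis mod_diff_right_eq mod_mult_self1_is_0 diff_zero)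
qed

lemma frac_nat_mult_frac: "frac (real k * frac t) = frac (real k * t)"
proof -
  have "real k * frac t = real k * t - of_int (int k * \<lfloor>t\<rfloor>)" by (simp add: frac_def algebra_simps)
  thus ?thesis by (simp only: frac_def floor_diff_of_int)
qed

text \<open>Points of \<open>\<Prod>i<p. \<int>/k\<^sub>i\<close> are encoded in the cyclic group \<open>\<int>/(\<Prod>i<p. k\<^sub>i)\<close> by the Chinese
  remainder theorem.\<close>

locale coprime_grid =
  fixes p :: nat and k :: "nat \<Rightarrow> nat"
  assumes moduli_pos: "\<And>i. i < p \<Longrightarrow> 0 < k i"
    and moduli_coprime: "\<And>i j. i < p \<Longrightarrow> j < p \<Longrightarrow> i \<noteq> j \<Longrightarrow> coprime (k i) (k j)"
begin

definition order :: nat where "order = (\<Prod>i<p. k i)"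

lemma order_pos: "0 < order"
  using moduli_pos by (auto simp: order_def)

lemma code_exists:
  fixes v :: "nat \<Rightarrow> int"
  shows "\<exists>!s. s \<in> {0..<int order} \<and> (\<forall>i<p. s mod int (k i) = v i mod int (k i))"
proof -
  \<comment> \<open>The Chinese remainder theorem is applied to natural numbers, so integer residues
    are first reduced to representatives in [0, k_i).\<close>
  have "\<exists>!x::nat. x < (\<Prod>i\<in>{..<p}. k i) \<and> (\<forall>i\<in>{..<p}. [x = nat (v i mod int (k i))] (mod k i))"
    using moduli_pos moduli_coprime by (intro chinese_remainder_unique_nat) auto
  then obtain x where x: "x < order" "\<And>i. i < p \<Longrightarrow> [x = nat (v i mod int (k i))] (mod k i)"
    and uniq: "\<And>y. y < order \<Longrightarrow> (\<And>i. i < p \<Longrightarrow> [y = nat (v i mod int (k i))] (mod k i)) \<Longrightarrow> y = x"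
    unfolding order_def by (auto simp: Ball_def)
  have iff: "[y = nat (v i mod int (k i))] (mod k i) \<longleftrightarrow> int y mod int (k i) = v i mod int (k i)" if "i < p" for y i
  proof -
    have "[y = nat (v i mod int (k i))] (mod k i) \<longleftrightarrow> [int y = int (nat (v i mod int (k i)))] (mod int (k i))"
      by (simp only: cong_int_iff)
    also have "int (nat (v i mod int (k i))) = v i mod int (k i)" using moduli_pos[OF that] by simp
    finally show ?thesis by (simp add: cong_def)
  qed
  show ?thesis
  proof (rule ex1I[of _ "int x"])
    show "int x \<in> {0..<int order} \<and> (\<forall>i<p. int x mod int (k i) = v i mod int (k i))"
      using x iff by auto
    fix s assume s: "s \<in> {0..<int order} \<and> (\<forall>i<p. s mod int (k i) = v i mod int (k i))"
    hence "nat s = x" using iff by (intro uniq) auto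
    thus "s = int x" using s by auto
  qed
qed

definition code :: "(nat \<Rightarrow> int) \<Rightarrow> int" where
  "code v = (THE s. s \<in> {0..<int order} \<and> (\<forall>i<p. s mod int (k i) = v i mod int (k i)))"

lemma code_range: "code v \<in> {0..<int order}"
  and code_mod: "i < p \<Longrightarrow> code v mod int (k i) = v i mod int (k i)"
  for v :: "nat \<Rightarrow> int"
  using theI'[OF code_exists[of v]] unfolding code_def[symmetric] by blast+

lemma code_eqI:
  fixes v :: "nat \<Rightarrow> int"
  shows "s \<in> {0..<int order} \<Longrightarrow> (\<And>i. i < p \<Longrightarrow> s mod int (k i) = v i mod int (k i)) \<Longrightarrow> code v = s"
  using code_exists[of v] code_range[of v] code_mod[of _ v] by blast

lemma mod_order_mod: "i < p \<Longrightarrow> (s mod int order) mod int (k i) = s mod int (k i)"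
  by (rule mod_mod_cancel) (auto simp: order_def intro!: dvd_prodI)

text \<open>An integer is known modulo the order once it is known modulo each k_i; all identities
  between codes are checked in this way.\<close>

lemma mod_order_eq_code:
  fixes v :: "nat \<Rightarrow> int"
  assumes "\<And>i. i < p \<Longrightarrow> s mod int (k i) = v i mod int (k i)"
  shows "s mod int order = code v"
  by (rule code_eqI[symmetric]) (use order_pos assms in \<open>auto simp: mod_order_mod\<close>)

definition idx :: "(nat \<Rightarrow> complex) \<Rightarrow> nat \<Rightarrow> int" where
  "idx x i = \<lfloor>k i * turn (x i)\<rfloor>"

definition cell :: "(nat \<Rightarrow> complex) \<Rightarrow> int" where
  "cell x = code (idx x)"

lemma idx_range: "i < p \<Longrightarrow> idx x i \<in> {0..<int (k i)}"
  using turn_nonneg[of "x i"] turn_less_1[of "x i"] moduli_pos[of i]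
  by (auto simp: idx_def floor_less_iff)

lemma cell_range: "cell x \<in> {0..<int order}"
  unfolding cell_def by (rule code_range)

lemma cell_mod: "i < p \<Longrightarrow> cell x mod int (k i) = idx x i"
  unfolding cell_def using idx_range[of i x] by (simp add: code_mod)

lemma measurable_cell [measurable]: "cell \<in> haar p \<rightarrow>\<^sub>M count_space UNIV"
proof -
  have "{x \<in> space (haar p). cell x = s} \<in> sets (haar p)" for s
  proof (cases "s \<in> {0..<int order}")
    case True
    have "cell x = s \<longleftrightarrow> (\<forall>i\<in>{..<p}. idx x i = s mod int (k i))" for x
    proof
      assume "\<forall>i\<in>{..<p}. idx x i = s mod int (k i)"
      thus "cell x = s" unfolding cell_def using True by (intro code_eqI) auto
    qed (use cell_mod in auto)
    moreover have "{x \<in> space (haar p). \<forall>i\<in>{..<p}. idx x i = s mod int (k i)} \<in> sets (haar p)"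
      unfolding idx_def by measurable
    ultimately show ?thesis by simp
  next
    case False
    hence "{x \<in> space (haar p). cell x = s} = {}" using cell_range by auto
    thus ?thesis by (simp only: sets.empty_sets)
  qed
  moreover have "cell -` {s} \<inter> space (haar p) = {x \<in> space (haar p). cell x = s}" for s by auto
  ultimately show ?thesis
    by (subst measurable_count_space_eq2_countable) auto
qed

definition shift :: "(nat \<Rightarrow> int) \<Rightarrow> (nat \<Rightarrow> complex) \<Rightarrow> nat \<Rightarrow> complex" where
  "shift v = rotation p (\<lambda>i. v i / k i)"

lemma turn_shift:
  assumes "x \<in> torus p" "i < p"
  shows "turn (shift v x i) = frac (turn (x i) + v i / k i)"
  using turn_mult_cis[of "x i" "v i / k i"] assms by (simp add: shift_def rotation_def torus_def PiE_iff)

lemma idx_shift: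
  assumes "x \<in> torus p" "i < p"
  shows "idx (shift v x) i mod int (k i) = (idx x i + v i) mod int (k i)"
proof -
  have "k i * (turn (x i) + v i / k i) = k i * turn (x i) + v i"
    using moduli_pos[OF assms(2)] by (simp add: field_simps)
  thus ?thesis
    by (simp add: idx_def turn_shift[OF assms] floor_nat_mult_frac_mod)
qed

lemma frac_shift:
  assumes "x \<in> torus p" "i < p"
  shows "frac (k i * turn (shift v x i)) = frac (k i * turn (x i))"
proof -
  have "k i * (turn (x i) + v i / k i) = k i * turn (x i) + v i"
    using moduli_pos[OF assms(2)] by (simp add: field_simps)
  thus ?thesis
    unfolding turn_shift[OF assms] frac_nat_mult_frac by (simp add: frac_def)
qed

text \<open>The encoding is a group homomorphism, so a translation on the torus becomes an addition
  in the cyclic group.\<close>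

lemma cell_shift:
  assumes "x \<in> torus p"
  shows "cell (shift v x) = (cell x + code v) mod order"
  unfolding cell_def
proof (rule code_eqI)
  fix i assume i: "i < p"
  have "(cell x + code v) mod int (k i) = (idx x i + v i) mod int (k i)"
    using i by (metis cell_def code_mod mod_add_eq)
  thus "(code (idx x) + code v) mod int order mod int (k i) = idx (shift v x) i mod int (k i)"
    using i assms by (simp add: mod_order_mod idx_shift flip: cell_def)
qed (use order_pos in auto)

text \<open>By invariance of Haar measure under grid translations all cells have the same mass, and
  these masses add up to 1.\<close>

lemma uniform_partition_cell: "uniform_partition (haar p) order cell"
proof -
  interpret prob_space "haar p" by (rule prob_space_haar)
  have shift_meas: "prob {x \<in> space (haar p). cell x = s} = prob {x \<in> space (haar p). cell x = 0}"
    if s: "s \<in> {0..<int order}" for s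
  proof -
    have shift_iff: "cell (shift (\<lambda>_. s) x) = s \<longleftrightarrow> cell x = 0" if "x \<in> torus p" for x
    proof -
      \<comment> \<open>The constant vector s has the residues of s itself, so it is the translation
        that carries cell 0 to cell s.\<close>
      have "code (\<lambda>_. s) = s" using s by (intro code_eqI) auto
      hence "cell (shift (\<lambda>_. s) x) = s \<longleftrightarrow> (cell x + s) mod int order = (0 + s) mod int order"
        using s that by (simp add: cell_shift)
      also have "\<dots> \<longleftrightarrow> cell x mod int order = 0 mod int order"
        by (metis add_diff_cancel_right' mod_add_left_eq mod_diff_left_eq)
      finally show ?thesis using cell_range[of x] by simp
    qed
    have "prob {x \<in> space (haar p). cell x = s}
        = measure (distr (haar p) (haar p) (shift (\<lambda>_. s))) {x \<in> space (haar p). cell x = s}"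
      unfolding shift_def by (simp add: haar_rotate)
    also have "\<dots> = prob (shift (\<lambda>_. s) -` {x \<in> space (haar p). cell x = s} \<inter> space (haar p))"
      unfolding shift_def by (rule measure_distr) measurable
    also have "\<dots> = prob {x \<in> space (haar p). cell x = 0}"
    proof (rule measure_eq_AE)
      show "AE x in haar p. x \<in> shift (\<lambda>_. s) -` {x \<in> space (haar p). cell x = s} \<inter> space (haar p)
          \<longleftrightarrow> x \<in> {x \<in> space (haar p). cell x = 0}"
        using AE_haar_torus AE_space
        by eventually_elim (use shift_iff measurable_space[OF measurable_rotate] in \<open>auto simp: shift_def\<close>)
    qed (unfold shift_def, measurable)
    finally show ?thesis .
  qed
  have "(\<Sum>s\<in>{0..<int order}. prob {x \<in> space (haar p). cell x = s})
      = prob (\<Union>s\<in>{0..<int order}. {x \<in> space (haar p). cell x = s})"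
    by (intro finite_measure_finite_Union[symmetric]) (auto simp: disjoint_family_on_def)
  also have "(\<Union>s\<in>{0..<int order}. {x \<in> space (haar p). cell x = s}) = space (haar p)"
    using cell_range by auto
  also have "(\<Sum>s\<in>{0..<int order}. prob {x \<in> space (haar p). cell x = s})
      = (\<Sum>s\<in>{0..<int order}. prob {x \<in> space (haar p). cell x = 0})"
    by (rule sum.cong[OF refl]) (rule shift_meas)
  finally have "real order * prob {x \<in> space (haar p). cell x = 0} = 1"
    by (simp add: prob_space)
  hence zero: "prob {x \<in> space (haar p). cell x = 0} = 1 / order"
    using order_pos by (simp add: field_simps)
  have "prob {x \<in> space (haar p). cell x = s} = 1 / order" if "s \<in> {0..<int order}" for s
    unfolding shift_meas[OF that] by (rule zero)
  thus ?thesis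
    using order_pos cell_range by unfold_locales auto
qed

sublocale haar: uniform_partition "haar p" order cell
  by (rule uniform_partition_cell)

text \<open>Within a box the angles differ by at most 1 / k_i of a turn, and a chord is no longer
  than its arc.\<close>

lemma dist_cell_le:
  assumes "x \<in> torus p" "y \<in> torus p" "cell x = cell y" "i < p"
  shows "dist (x i) (y i) \<le> 2 * pi / k i"
proof -
  have "idx x i = idx y i" using assms cell_mod by metis
  hence "\<bar>k i * turn (x i) - k i * turn (y i)\<bar> \<le> 1"
    unfolding idx_def by linarith
  hence "k i * \<bar>turn (x i) - turn (y i)\<bar> \<le> 1"
    by (simp add: abs_mult flip: right_diff_distrib)
  hence close: "\<bar>turn (x i) - turn (y i)\<bar> \<le> 1 / k i"
    using moduli_pos[OF assms(4)] by (simp add: field_simps)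
  have eq: "x i = y i * cis (2 * pi * (turn (x i) - turn (y i)))"
    using cis_turn[of "x i"] cis_turn[of "y i"] assms
    by (auto simp: torus_def PiE_iff right_diff_distrib simp flip: cis_divide)
  have "dist (x i) (y i) = dist (cis (2 * pi * (turn (x i) - turn (y i)))) 1"
  proof -
    have "x i - y i = y i * (cis (2 * pi * (turn (x i) - turn (y i))) - 1)"
      by (subst eq) (simp add: algebra_simps)
    thus ?thesis using assms by (auto simp: dist_norm norm_mult torus_def PiE_iff)
  qed
  also have "\<dots> \<le> \<bar>2 * pi * (turn (x i) - turn (y i))\<bar>" by (rule dist_cis_one_le)
  also have "\<dots> = 2 * pi * \<bar>turn (x i) - turn (y i)\<bar>" by (simp add: abs_mult)
  also have "\<dots> \<le> 2 * pi * (1 / k i)" by (intro mult_left_mono close) auto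
  finally show ?thesis by simp
qed

lemma cell_average_close:
  assumes f: "integrable (haar p) f" and v: "integrable (haar p) v"
    and v_uc: "\<And>x y. (\<And>i. i < p \<Longrightarrow> dist (x i) (y i) < \<delta>) \<Longrightarrow> \<bar>v x - v y\<bar> \<le> \<epsilon>"
    and fv: "(\<integral>x. \<bar>f x - v x\<bar> \<partial>haar p) \<le> \<epsilon>"
    and fine: "\<And>i. i < p \<Longrightarrow> 2 * pi / k i < \<delta>"
  shows "(\<integral>x. \<bar>f x - order * haar.cell_integral f (cell x)\<bar> \<partial>haar p) \<le> 4 * \<epsilon>"
proof -
  \<comment> \<open>A step function sampled from v, one point of the torus per cell. It is within
    \<epsilon> of v, hence within 2 \<epsilon> of f in the mean; replacing it by the cell averages
    doubles this to 4 \<epsilon>.\<close>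
  define g where "g s = v (SOME y. y \<in> torus p \<and> cell y = s)" for s
  have g: "\<bar>v x - g (cell x)\<bar> \<le> \<epsilon>" if x: "x \<in> torus p" for x
  proof -
    define y where "y = (SOME y. y \<in> torus p \<and> cell y = cell x)"
    have "y \<in> torus p \<and> cell y = cell x" unfolding y_def by (rule someI[of _ x]) (use x in auto)
    hence "dist (x i) (y i) < \<delta>" if "i < p" for i
      using dist_cell_le[of x y i] x fine[OF that] that by auto
    thus ?thesis unfolding g_def y_def[symmetric] by (rule v_uc)
  qed
  have "(\<integral>x. \<bar>f x - g (cell x)\<bar> \<partial>haar p) \<le> (\<integral>x. \<bar>f x - v x\<bar> + \<epsilon> \<partial>haar p)"
  proof (rule integral_mono_AE)
    show "AE x in haar p. \<bar>f x - g (cell x)\<bar> \<le> \<bar>f x - v x\<bar> + \<epsilon>"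
      using AE_haar_torus by eventually_elim (use g in force)
  qed (use f v haar.integrable_step[of g] in auto)
  also have "\<dots> = (\<integral>x. \<bar>f x - v x\<bar> \<partial>haar p) + \<epsilon>"
    using f v by (simp add: haar.prob_space)
  finally have "(\<integral>x. \<bar>f x - g (cell x)\<bar> \<partial>haar p) \<le> 2 * \<epsilon>" using fv by simp
  thus ?thesis using haar.abs_diff_cell_average_le[OF f, of g] by linarith
qed

text \<open>The carry produced when the integer parts of \<open>k\<^sub>i x\<^sub>j\<close> rather than the numbers themselves are
  combined.\<close>

definition carry :: "nat \<Rightarrow> (nat \<Rightarrow> int) \<Rightarrow> (nat \<Rightarrow> nat \<Rightarrow> complex) \<Rightarrow> nat \<Rightarrow> int" where
  "carry m c x = (\<lambda>i\<in>{..<p}. \<lfloor>\<Sum>j<m. c j * frac (k i * turn (x j i))\<rfloor>)"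

text \<open>The linear combination formed in the cyclic group after rounding, to which the
  hypothesis on cyclic groups applies.\<close>

definition cell_sum :: "nat \<Rightarrow> (nat \<Rightarrow> int) \<Rightarrow> (nat \<Rightarrow> nat \<Rightarrow> complex) \<Rightarrow> int" where
  "cell_sum m c x = (\<Sum>j<m. c j * cell (x j)) mod order"

text \<open>Fractional parts lie in [0, 1). What matters is that the moduli do not occur in the
  bound.\<close>

lemma carry_range: "carry m c x \<in> {..<p} \<rightarrow>\<^sub>E {- (\<Sum>j<m. \<bar>c j\<bar>)..(\<Sum>j<m. \<bar>c j\<bar>)}"
proof -
  have "\<lfloor>\<Sum>j<m. c j * frac (k i * turn (x j i))\<rfloor> \<in> {- (\<Sum>j<m. \<bar>c j\<bar>)..(\<Sum>j<m. \<bar>c j\<bar>)}" for i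
  proof -
    have "\<bar>\<Sum>j<m. c j * frac (k i * turn (x j i))\<bar> \<le> (\<Sum>j<m. \<bar>c j * frac (k i * turn (x j i))\<bar>)"
      by (rule sum_abs)
    also have "\<dots> \<le> (\<Sum>j<m. of_int \<bar>c j\<bar>)"
      by (intro sum_mono) (auto simp: abs_mult intro!: mult_left_le less_imp_le[OF frac_lt_1])
    finally have "\<bar>\<Sum>j<m. c j * frac (k i * turn (x j i))\<bar> \<le> of_int (\<Sum>j<m. \<bar>c j\<bar>)" by simp
    thus ?thesis by (auto simp: abs_le_iff le_floor_iff floor_le_iff)
  qed
  thus ?thesis unfolding carry_def by auto
qed

text \<open>Modulo each k_i: writing k_i x_j as integer part plus fractional part, the integer
  combination leaves the floor and the rest is the carry.\<close>

lemma cell_torus_lincomb: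
  assumes x: "\<And>j. j < m \<Longrightarrow> x j \<in> torus p"
  shows "cell (torus_lincomb p m c x) = (cell_sum m c x + code (carry m c x)) mod order"
  unfolding cell_def[of "torus_lincomb p m c x"]
proof (rule code_eqI)
  fix i assume i: "i < p"
  have "(\<Sum>j<m. k i * (c j * turn (x j i)))
      = of_int (\<Sum>j<m. c j * idx (x j) i) + (\<Sum>j<m. c j * frac (k i * turn (x j i)))"
    by (simp add: idx_def frac_def algebra_simps flip: sum.distrib)
  hence "\<lfloor>\<Sum>j<m. k i * (c j * turn (x j i))\<rfloor>
      = (\<Sum>j<m. c j * idx (x j) i) + \<lfloor>\<Sum>j<m. c j * frac (k i * turn (x j i))\<rfloor>"
    by (simp only: int_add_floor)
  also have "\<lfloor>\<Sum>j<m. c j * frac (k i * turn (x j i))\<rfloor> = carry m c x i"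
    using i by (simp add: carry_def)
  finally have "\<lfloor>\<Sum>j<m. k i * (c j * turn (x j i))\<rfloor> = (\<Sum>j<m. c j * idx (x j) i) + carry m c x i" .
  hence "idx (torus_lincomb p m c x) i mod int (k i) = ((\<Sum>j<m. c j * idx (x j) i) + carry m c x i) mod int (k i)"
    using i x by (simp add: idx_def[of "torus_lincomb p m c x"] turn_torus_lincomb
        floor_nat_mult_frac_mod sum_distrib_left)
  also have "\<dots> = ((\<Sum>j<m. c j * idx (x j) i) mod int (k i) + carry m c x i mod int (k i)) mod int (k i)"
    by (simp add: mod_add_eq)
  also have "(\<Sum>j<m. c j * idx (x j) i) mod int (k i) = (\<Sum>j<m. c j * cell (x j)) mod int (k i)"
  proof -
    have "[idx (x j) i = cell (x j)] (mod int (k i))" for j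
      using i by (simp add: cong_def cell_mod[symmetric])
    hence "[(\<Sum>j<m. c j * idx (x j) i) = (\<Sum>j<m. c j * cell (x j))] (mod int (k i))"
      by (intro cong_sum cong_scalar_left)
    thus ?thesis by (simp add: cong_def)
  qed
  also have "\<dots> = cell_sum m c x mod int (k i)" using i by (simp add: cell_sum_def mod_order_mod)
  also have "carry m c x i mod int (k i) = code (carry m c x) mod int (k i)" using i by (simp add: code_mod)
  finally show "(cell_sum m c x + code (carry m c x)) mod int order mod int (k i)
      = idx (torus_lincomb p m c x) i mod int (k i)"
    using i by (simp add: mod_order_mod mod_add_eq)
qed (use order_pos in auto)

lemma carry_shift:
  assumes "\<And>j. j < m \<Longrightarrow> x j \<in> torus p"
  shows "carry m c (\<lambda>j. shift (v j) (x j)) = carry m c x"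
  unfolding carry_def using assms by (auto simp: frac_shift intro!: restrict_ext sum.cong arg_cong[of _ _ floor])

lemma cell_sum_shift:
  assumes x: "\<And>j. j < m \<Longrightarrow> x j \<in> torus p" and b: "(\<Sum>j<m. c j * b j) = 1"
  shows "cell_sum m c (\<lambda>j. shift (\<lambda>i. b j * e i) (x j)) = (cell_sum m c x + code e) mod order"
proof -
  have code_mult: "[code (\<lambda>i. b j * e i) = b j * code e] (mod int order)" for j
  proof -
    have "(b j * code e) mod int order = code (\<lambda>i. b j * e i)"
      by (rule mod_order_eq_code) (metis code_mod mod_mult_right_eq)
    thus ?thesis by (metis cong_def mod_mod_trivial)
  qed
  have "[(\<Sum>j<m. c j * cell (shift (\<lambda>i. b j * e i) (x j))) = (\<Sum>j<m. c j * (cell (x j) + b j * code e))] (mod int order)"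
  proof (intro cong_sum cong_scalar_left)
    fix j assume j: "j \<in> {..<m}"
    have "[cell (shift (\<lambda>i. b j * e i) (x j)) = cell (x j) + code (\<lambda>i. b j * e i)] (mod int order)"
      using x j by (simp add: cell_shift cong_def)
    also have "[cell (x j) + code (\<lambda>i. b j * e i) = cell (x j) + b j * code e] (mod int order)"
      by (intro cong_add cong_refl code_mult)
    finally show "[cell (shift (\<lambda>i. b j * e i) (x j)) = cell (x j) + b j * code e] (mod int order)" .
  qed
  \<comment> \<open>Here the Bezout coefficients do their work: the total displacement is exactly
    one copy of \<open>code e\<close>.\<close>
  also have "(\<Sum>j<m. c j * (cell (x j) + b j * code e)) = (\<Sum>j<m. c j * cell (x j)) + (\<Sum>j<m. c j * b j) * code e"
    by (simp add: algebra_simps sum.distrib sum_distrib_left)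
  finally show ?thesis
    by (simp add: cell_sum_def cong_def b mod_add_left_eq)
qed

end

text \<open>Three exchanges of cost \<epsilon> each: u by v, v by its rotated copy, and v back by u.
  The middle one relies on invariance of Haar measure, which moves the rotation from v to the test
  function.\<close>

lemma tv_close_rotate:
  assumes u: "u \<in> borel_measurable (haar p)" "\<And>x. 0 \<le> u x" and \<mu>: "\<mu> = density (haar p) (\<lambda>x. ennreal (u x))"
    and u_int: "integrable (haar p) u" and v: "integrable (haar p) v"
    and v_uc: "\<And>x y. (\<And>i. i < p \<Longrightarrow> dist (x i) (y i) < \<delta>) \<Longrightarrow> \<bar>v x - v y\<bar> \<le> \<epsilon>"
    and uv: "(\<integral>x. \<bar>u x - v x\<bar> \<partial>haar p) \<le> \<epsilon>"
    and small: "\<And>i. i < p \<Longrightarrow> \<bar>2 * pi * t i\<bar> < \<delta>"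
  shows "tv_close \<mu> (distr \<mu> (haar p) (rotation p t)) (3 * \<epsilon>)"
  unfolding tv_close_def
proof (intro conjI ballI impI)
  show "sets \<mu> = sets (distr \<mu> (haar p) (rotation p t))" by (simp add: \<mu>)
  interpret prob_space "haar p" by (rule prob_space_haar)
  fix h :: "(nat \<Rightarrow> complex) \<Rightarrow> real"
  assume "h \<in> borel_measurable \<mu>" and h01: "\<forall>x. 0 \<le> h x \<and> h x \<le> 1"
  hence h [measurable]: "h \<in> borel_measurable (haar p)" by (simp add: \<mu>)
  note [measurable] = u(1)
  let ?r = "rotation p t"
  have bounded: "integrable (haar p) (\<lambda>x. f x * g x)"
    if "integrable (haar p) f" "g \<in> borel_measurable (haar p)" "\<And>x. 0 \<le> g x \<and> g x \<le> 1" for f g :: "_ \<Rightarrow> real"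
  proof (rule Bochner_Integration.integrable_bound[OF that(1)])
    show "AE x in haar p. norm (f x * g x) \<le> norm (f x)"
      using that(3) by (intro AE_I2) (auto simp: abs_mult intro!: mult_left_le)
  qed (use that in auto)
  have close: "\<bar>(\<integral>x. f x * g x \<partial>haar p) - (\<integral>x. f' x * g x \<partial>haar p)\<bar> \<le> (\<integral>x. \<bar>f x - f' x\<bar> \<partial>haar p)"
    if f: "integrable (haar p) f" "integrable (haar p) f'"
      and g: "g \<in> borel_measurable (haar p)" "\<And>x. 0 \<le> g x \<and> g x \<le> 1" for f f' g :: "_ \<Rightarrow> real"
  proof -
    have "\<bar>(\<integral>x. f x * g x \<partial>haar p) - (\<integral>x. f' x * g x \<partial>haar p)\<bar> = \<bar>\<integral>x. f x * g x - f' x * g x \<partial>haar p\<bar>"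
      using bounded[OF f(1) g] bounded[OF f(2) g] by simp
    also have "\<dots> \<le> (\<integral>x. \<bar>f x * g x - f' x * g x\<bar> \<partial>haar p)" by (rule integral_abs_bound)
    also have "\<dots> \<le> (\<integral>x. \<bar>f x - f' x\<bar> \<partial>haar p)"
    proof (rule integral_mono)
      show "\<bar>f x * g x - f' x * g x\<bar> \<le> \<bar>f x - f' x\<bar>" for x
        using g(2)[of x] by (simp add: abs_mult mult_left_le flip: left_diff_distrib)
    qed (use f bounded[OF f(1) g] bounded[OF f(2) g] in auto)
    finally show ?thesis .
  qed
  have [measurable]: "(\<lambda>x. h (?r x)) \<in> borel_measurable (haar p)" "v \<in> borel_measurable (haar p)"
    using v by auto
  have v_r: "integrable (haar p) (\<lambda>x. v (?r x))"
    by (rule integrable_distr[OF measurable_rotate]) (simp add: haar_rotate v)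
  have dist_v: "(\<integral>x. \<bar>v (?r x) - v x\<bar> \<partial>haar p) \<le> \<epsilon>"
  proof -
    have "(\<integral>x. \<bar>v (?r x) - v x\<bar> \<partial>haar p) \<le> (\<integral>x. \<epsilon> \<partial>haar p)"
    proof (rule integral_mono_AE)
      show "AE x in haar p. \<bar>v (?r x) - v x\<bar> \<le> \<epsilon>"
        using AE_haar_torus
      proof eventually_elim
        case (elim x)
        have "dist (?r x i) (x i) < \<delta>" if i: "i < p" for i
        proof -
          have "?r x i - x i = x i * (cis (2 * pi * t i) - 1)"
            using i by (simp add: rotation_def algebra_simps)
          hence "dist (?r x i) (x i) = dist (cis (2 * pi * t i)) 1"
            using elim i by (simp add: dist_norm norm_mult torus_def PiE_iff)
          also have "\<dots> \<le> \<bar>2 * pi * t i\<bar>" by (rule dist_cis_one_le)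
          finally show ?thesis using small[OF i] by linarith
        qed
        thus ?case by (rule v_uc)
      qed
    qed (use v v_r in auto)
    thus ?thesis by (simp add: prob_space)
  qed
  have "(\<integral>x. h x \<partial>\<mu>) = (\<integral>x. u x * h x \<partial>haar p)"
    using u by (simp add: \<mu> integral_real_density)
  moreover have "(\<integral>x. h x \<partial>distr \<mu> (haar p) ?r) = (\<integral>x. u x * h (?r x) \<partial>haar p)"
    using u by (simp add: \<mu> integral_distr integral_real_density)
  moreover have "(\<integral>x. v x * h x \<partial>haar p) = (\<integral>x. v (?r x) * h (?r x) \<partial>haar p)"
    by (subst haar_rotate[of p t, symmetric]) (simp add: integral_distr)
  moreover have "\<bar>(\<integral>x. u x * h x \<partial>haar p) - (\<integral>x. v x * h x \<partial>haar p)\<bar> \<le> \<epsilon>"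
    using close[OF u_int v h] h01 uv by (auto intro: order_trans)
  moreover have "\<bar>(\<integral>x. u x * h (?r x) \<partial>haar p) - (\<integral>x. v x * h (?r x) \<partial>haar p)\<bar> \<le> \<epsilon>"
    using close[OF u_int v, of "\<lambda>x. h (?r x)"] h01 uv by (auto intro: order_trans)
  moreover have "\<bar>(\<integral>x. v (?r x) * h (?r x) \<partial>haar p) - (\<integral>x. v x * h (?r x) \<partial>haar p)\<bar> \<le> \<epsilon>"
    using close[OF v_r v, of "\<lambda>x. h (?r x)"] h01 dist_v by (auto intro: order_trans)
  ultimately show "\<bar>(\<integral>x. h x \<partial>\<mu>) - (\<integral>x. h x \<partial>distr \<mu> (haar p) ?r)\<bar> \<le> 3 * \<epsilon>"
    by linarith
qed

section \<open>Convergence of the entropies\<close>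

text \<open>A new entry is absorbed by the two-term identity: it receives the coefficient u, and the
  old coefficients are scaled by v.\<close>

lemma bezout_int_family:
  fixes c :: "nat \<Rightarrow> int"
  obtains b where "(\<Sum>j<m. c j * b j) = Gcd (c ` {..<m})"
proof -
  have "\<exists>b. (\<Sum>j<m. c j * b j) = Gcd (c ` {..<m})"
  proof (induction m)
    case (Suc m)
    then obtain b where b: "(\<Sum>j<m. c j * b j) = Gcd (c ` {..<m})" by blast
    obtain u v where uv: "u * c m + v * Gcd (c ` {..<m}) = gcd (c m) (Gcd (c ` {..<m}))"
      using bezout_int by blast
    have "(\<Sum>j<Suc m. c j * (if j = m then u else v * b j)) = v * (\<Sum>j<m. c j * b j) + u * c m"
      by (simp add: sum_distrib_left algebra_simps)
    also have "\<dots> = Gcd (c ` {..<Suc m})"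
      using uv by (simp add: b lessThan_Suc add.commute)
    finally show ?case by (intro exI[of _ "\<lambda>j. if j = m then u else v * b j"])
  qed simp
  thus ?thesis using that by blast
qed

text \<open>A window in the list of primes that slides to infinity: distinct entries are coprime,
  and all entries grow with N.\<close>

definition prime_moduli :: "nat \<Rightarrow> nat \<Rightarrow> nat" where
  "prime_moduli N i = enumerate {q. prime q} (N + i)"

lemma prime_prime_moduli: "prime (prime_moduli N i)"
  using enumerate_in_set[OF primes_infinite] by (auto simp: prime_moduli_def)

lemma prime_moduli_ge: "N \<le> prime_moduli N i"
  using le_enumerate[OF primes_infinite, of "N + i"] by (simp add: prime_moduli_def)

lemma coprime_grid_prime_moduli: "coprime_grid p (prime_moduli N)"
proof
  fix i j :: nat assume "i \<noteq> j"
  hence "prime_moduli N i \<noteq> prime_moduli N j"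
    by (simp add: prime_moduli_def inj_eq[OF inj_enumerate[OF primes_infinite]])
  thus "coprime (prime_moduli N i) (prime_moduli N j)"
    using prime_prime_moduli by (intro primes_coprime)
qed (use prime_prime_moduli prime_gt_0_nat in blast)

text \<open>The hypothesis is applied to the set where f \<ge> g and to its complement, whence the
  factor 2 between event-wise and l^1 distance.\<close>

lemma sum_abs_diff_le:
  fixes f g :: "'a \<Rightarrow> real"
  assumes "finite S" and "\<And>B. B \<subseteq> S \<Longrightarrow> \<bar>(\<Sum>s\<in>B. f s) - (\<Sum>s\<in>B. g s)\<bar> \<le> d"
  shows "(\<Sum>s\<in>S. \<bar>f s - g s\<bar>) \<le> 2 * d"
proof -
  define P where "P = {s \<in> S. g s \<le> f s}"
  have "(\<Sum>s\<in>S. \<bar>f s - g s\<bar>) = (\<Sum>s\<in>P. \<bar>f s - g s\<bar>) + (\<Sum>s\<in>S - P. \<bar>f s - g s\<bar>)"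
    using assms(1) by (subst sum.subset_diff[of P S]) (auto simp: P_def)
  also have "(\<Sum>s\<in>P. \<bar>f s - g s\<bar>) = (\<Sum>s\<in>P. f s) - (\<Sum>s\<in>P. g s)"
    unfolding sum_subtractf[symmetric] by (intro sum.cong) (auto simp: P_def)
  also have "(\<Sum>s\<in>S - P. \<bar>f s - g s\<bar>) = (\<Sum>s\<in>S - P. g s) - (\<Sum>s\<in>S - P. f s)"
    unfolding sum_subtractf[symmetric] by (intro sum.cong) (auto simp: P_def)
  finally show ?thesis
    using assms(2)[of P] assms(2)[of "S - P"] by (auto simp: P_def)
qed

lemma measurable_PiM_count_space:
  fixes g :: "('i \<Rightarrow> 'c::countable) \<Rightarrow> 'd"
  assumes "finite I"
  shows "g \<in> (\<Pi>\<^sub>M i\<in>I. count_space UNIV) \<rightarrow>\<^sub>M count_space UNIV"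
  using assms by (subst count_space_PiM_finite) auto

section \<open>Discrete entropy, and total variation for independent variables\<close>

context prob_space
begin

lemma entropy_finite_range:
  fixes V :: "'a \<Rightarrow> int"
  assumes [measurable]: "V \<in> M \<rightarrow>\<^sub>M count_space UNIV" and V: "\<And>\<omega>. \<omega> \<in> space M \<Longrightarrow> V \<omega> \<in> S"
    and "finite S"
  shows "entropy 2 (count_space UNIV) V = - (\<Sum>s\<in>S. xlogx (prob {\<omega> \<in> space M. V \<omega> = s}))"
proof -
  interpret information_space M 2 by unfold_locales simp
  define P where "P s = prob {\<omega> \<in> space M. V \<omega> = s}" for s
  have P0: "P s = 0" if "s \<notin> S" for s
  proof -
    have "{\<omega> \<in> space M. V \<omega> = s} = {}" using V that by auto
    thus ?thesis unfolding P_def by (simp only: measure_empty)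
  qed
  \<comment> \<open>\<open>entropy\<close> is defined through Radon-Nikodym derivatives; with an
    explicit density against counting measure it becomes the Shannon sum.\<close>
  have "distributed M (count_space UNIV) V (\<lambda>s. ennreal (P s))"
    unfolding distributed_def
  proof (intro conjI)
    show "distr M (count_space UNIV) V = density (count_space UNIV) (\<lambda>s. ennreal (P s))"
    proof (rule measure_eqI_countable[of _ UNIV])
      fix s
      have "V -` {s} \<inter> space M = {\<omega> \<in> space M. V \<omega> = s}" by auto
      thus "emeasure (distr M (count_space UNIV) V) {s} = emeasure (density (count_space UNIV) (\<lambda>s. ennreal (P s))) {s}"
        by (simp add: emeasure_distr emeasure_density P_def emeasure_eq_measure nn_integral_count_space_indicator
            one_ennreal_def[symmetric] nn_integral_indicator_singleton)
    qed auto
  qed auto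
  hence "entropy 2 (count_space UNIV) V = - (\<integral>s. P s * log 2 (P s) \<partial>count_space UNIV)"
    by (rule entropy_distr) (simp add: P_def)
  also have "(\<integral>s. P s * log 2 (P s) \<partial>count_space UNIV) = (\<Sum>s\<in>S. xlogx (P s))"
  proof (subst lebesgue_integral_count_space_finite_support)
    have sub: "{s \<in> UNIV. P s * log 2 (P s) \<noteq> 0} \<subseteq> S" using P0 by auto
    thus "finite {s \<in> UNIV. P s * log 2 (P s) \<noteq> 0}" using assms(3) by (rule finite_subset)
    show "(\<Sum>s | s \<in> UNIV \<and> P s * log 2 (P s) \<noteq> 0. P s * log 2 (P s)) = (\<Sum>s\<in>S. xlogx (P s))"
      unfolding xlogx_def using sub by (intro sum.mono_neutral_left assms(3)) auto
  qed
  finally show ?thesis by (simp add: P_def)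
qed

lemma indep_vars_tv_close:
  fixes X :: "'i \<Rightarrow> 'a \<Rightarrow> 'b" and \<delta> :: real
  assumes indep: "indep_vars (\<lambda>_. M') X I" and I: "finite I" "I \<noteq> {}"
    and g: "\<And>i. i \<in> I \<Longrightarrow> g i \<in> M' \<rightarrow>\<^sub>M M'"
    and close: "\<And>i. i \<in> I \<Longrightarrow> tv_close (distr M M' (X i)) (distr (distr M M' (X i)) M' (g i)) \<delta>"
    and B: "B \<in> sets (\<Pi>\<^sub>M i\<in>I. M')"
  shows "\<bar>prob {\<omega> \<in> space M. (\<lambda>i\<in>I. X i \<omega>) \<in> B} - prob {\<omega> \<in> space M. (\<lambda>i\<in>I. g i (X i \<omega>)) \<in> B}\<bar> \<le> card I * \<delta>"
proof -
  have X [measurable]: "i \<in> I \<Longrightarrow> random_variable M' (X i)" for i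
    using indep by (auto simp: indep_vars_def)
  have gX [measurable]: "i \<in> I \<Longrightarrow> random_variable M' (\<lambda>\<omega>. g i (X i \<omega>))" for i
    by (rule measurable_compose[OF X g])
  have "indep_vars (\<lambda>_. M') (\<lambda>i \<omega>. g i (X i \<omega>)) I"
    by (rule indep_vars_compose2[OF indep]) (rule g)
  hence law_g: "distr M (\<Pi>\<^sub>M i\<in>I. M') (\<lambda>\<omega>. \<lambda>i\<in>I. g i (X i \<omega>)) = (\<Pi>\<^sub>M i\<in>I. distr M M' (\<lambda>\<omega>. g i (X i \<omega>)))"
    using gX by (subst (asm) indep_vars_iff_distr_eq_PiM'[OF I(2)]) auto
  have law: "distr M (\<Pi>\<^sub>M i\<in>I. M') (\<lambda>\<omega>. \<lambda>i\<in>I. X i \<omega>) = (\<Pi>\<^sub>M i\<in>I. distr M M' (X i))"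
    using indep X by (subst (asm) indep_vars_iff_distr_eq_PiM'[OF I(2)]) auto
  \<comment> \<open>The product bound wants probability measures at every index, so outside I both
    families repeat the law at \<open>i0\<close>.\<close>
  obtain i0 where i0: "i0 \<in> I" using I by blast
  define \<mu> where "\<mu> i = distr M M' (X (if i \<in> I then i else i0))" for i
  define \<nu> where "\<nu> i = (let j = (if i \<in> I then i else i0) in distr M M' (\<lambda>\<omega>. g j (X j \<omega>)))" for i
  have "tv_close (Pi\<^sub>M I \<mu>) (Pi\<^sub>M I \<nu>) (\<Sum>i\<in>I. \<delta>)"
  proof (rule tv_close_PiM[OF I(1)])
    show "prob_space (\<mu> i)" for i unfolding \<mu>_def using i0 by (intro prob_space_distr X) auto
    show "prob_space (\<nu> i)" for i unfolding \<nu>_def Let_def using i0 by (intro prob_space_distr gX) auto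
    show "tv_close (\<mu> i) (\<nu> i) \<delta>" if "i \<in> I" for i
      using close[OF that] that X[OF that] g[OF that] by (simp add: \<mu>_def \<nu>_def distr_distr comp_def)
  qed
  moreover have "Pi\<^sub>M I \<mu> = distr M (\<Pi>\<^sub>M i\<in>I. M') (\<lambda>\<omega>. \<lambda>i\<in>I. X i \<omega>)"
    unfolding law by (intro PiM_cong) (auto simp: \<mu>_def)
  moreover have "Pi\<^sub>M I \<nu> = distr M (\<Pi>\<^sub>M i\<in>I. M') (\<lambda>\<omega>. \<lambda>i\<in>I. g i (X i \<omega>))"
    unfolding law_g by (intro PiM_cong) (auto simp: \<nu>_def)
  ultimately have "\<bar>measure (distr M (\<Pi>\<^sub>M i\<in>I. M') (\<lambda>\<omega>. \<lambda>i\<in>I. X i \<omega>)) B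
      - measure (distr M (\<Pi>\<^sub>M i\<in>I. M') (\<lambda>\<omega>. \<lambda>i\<in>I. g i (X i \<omega>))) B\<bar> \<le> card I * \<delta>"
    using tv_close_measure[of _ _ "card I * \<delta>" B] B by simp
  moreover have "measure (distr M (\<Pi>\<^sub>M i\<in>I. M') Y) B = prob {\<omega> \<in> space M. Y \<omega> \<in> B}"
    if "Y \<in> M \<rightarrow>\<^sub>M (\<Pi>\<^sub>M i\<in>I. M')" for Y
    using that B by (simp add: measure_distr vimage_def Int_def conj_commute)
  ultimately show ?thesis by simp
qed

end

text \<open>The moduli are deliberately absent: one finite set serves all grids at once.\<close>

definition carries :: "nat \<Rightarrow> nat \<Rightarrow> (nat \<Rightarrow> int) \<Rightarrow> (nat \<Rightarrow> int) set" where
  "carries p m c = ({..<p} \<rightarrow>\<^sub>E {- (\<Sum>j<m. \<bar>c j\<bar>)..(\<Sum>j<m. \<bar>c j\<bar>)})"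

lemma finite_carries: "finite (carries p m c)"
  unfolding carries_def by (intro finite_PiE) auto

lemma carries_nonempty: "carries p m c \<noteq> {}"
  unfolding carries_def by (simp add: PiE_eq_empty_iff sum_nonneg)

lemma (in coprime_grid) carry_in_carries: "carry m c x \<in> carries p m c"
  unfolding carries_def by (rule carry_range)

section \<open>Independent torus-valued variables on a fixed grid\<close>

locale torus_variables = prob_space M + coprime_grid p k
  for M :: "'a measure" and p k +
  fixes m :: nat and X :: "nat \<Rightarrow> 'a \<Rightarrow> nat \<Rightarrow> complex"
  assumes indep: "indep_vars (\<lambda>_. haar p) X {..<m}"
    and X_torus: "\<And>j \<omega>. j < m \<Longrightarrow> \<omega> \<in> space M \<Longrightarrow> X j \<omega> \<in> torus p"
    and m_pos: "0 < m"
begin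

lemma X_measurable: "j < m \<Longrightarrow> random_variable (haar p) (X j)"
  using indep by (auto simp: indep_vars_def)

definition cell_sum_prob :: "(nat \<Rightarrow> int) \<Rightarrow> int \<Rightarrow> real" where
  "cell_sum_prob c s = prob {\<omega> \<in> space M. cell_sum m c (\<lambda>j. X j \<omega>) = s}"

lemma cell_sum_restrict: "cell_sum m c (\<lambda>j\<in>{..<m}. x j) = cell_sum m c x"
  by (simp add: cell_sum_def)

lemma carry_restrict: "carry m c (\<lambda>j\<in>{..<m}. x j) = carry m c x"
  by (simp add: carry_def)

lemma measurable_cells:
  "(\<lambda>x. \<lambda>j\<in>{..<m}. cell (x j)) \<in> (\<Pi>\<^sub>M j\<in>{..<m}. haar p) \<rightarrow>\<^sub>M (\<Pi>\<^sub>M j\<in>{..<m}. count_space UNIV)"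
  by measurable

lemma measurable_cell_sum [measurable]:
  "cell_sum m c \<in> (\<Pi>\<^sub>M j\<in>{..<m}. haar p) \<rightarrow>\<^sub>M count_space UNIV"
proof -
  have "(\<lambda>x. (\<Sum>j<m. c j * (\<lambda>j\<in>{..<m}. cell (x j)) j) mod int order)
      \<in> (\<Pi>\<^sub>M j\<in>{..<m}. haar p) \<rightarrow>\<^sub>M count_space UNIV"
    by (rule measurable_compose[OF measurable_cells measurable_PiM_count_space]) simp
  thus ?thesis by (simp add: cell_sum_def[abs_def])
qed

lemma measurable_carry [measurable]:
  "{x \<in> space (\<Pi>\<^sub>M j\<in>{..<m}. haar p). carry m c x = e} \<in> sets (\<Pi>\<^sub>M j\<in>{..<m}. haar p)"
proof (cases "e \<in> extensional {..<p}")
  case True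
  hence "carry m c x = e \<longleftrightarrow> (\<forall>i\<in>{..<p}. \<lfloor>\<Sum>j<m. c j * frac (k i * turn (x j i))\<rfloor> = e i)" for x
    unfolding carry_def by (auto simp: fun_eq_iff restrict_def extensional_def)
  moreover have "{x \<in> space (\<Pi>\<^sub>M j\<in>{..<m}. haar p).
      \<forall>i\<in>{..<p}. \<lfloor>\<Sum>j<m. c j * frac (k i * turn (x j i))\<rfloor> = e i} \<in> sets (\<Pi>\<^sub>M j\<in>{..<m}. haar p)"
  proof -
    have [measurable]: "(\<lambda>x. x j i) \<in> borel_measurable (\<Pi>\<^sub>M j\<in>{..<m}. haar p)" if "j < m" "i < p" for j i
    proof -
      have "(\<lambda>y. y i) \<in> borel_measurable (haar p)"
        unfolding measurable_cong_sets[OF sets_haar refl]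
        by (rule measurable_component_singleton) (use that in auto)
      thus ?thesis by (rule measurable_compose[rotated]) (use that in simp)
    qed
    show ?thesis unfolding frac_def by measurable
  qed
  ultimately show ?thesis by simp
next
  case False
  hence "{x \<in> space (\<Pi>\<^sub>M j\<in>{..<m}. haar p). carry m c x = e} = {}" by (auto simp: carry_def)
  thus ?thesis by (simp only: sets.empty_sets)
qed

lemma X_vector_measurable: "(\<lambda>\<omega>. \<lambda>j\<in>{..<m}. X j \<omega>) \<in> M \<rightarrow>\<^sub>M (\<Pi>\<^sub>M j\<in>{..<m}. haar p)"
  by (rule measurable_restrict) (simp add: X_measurable)

lemma events_carry_cell_sum:
  "{\<omega> \<in> space M. carry m c (\<lambda>j. X j \<omega>) = e \<and> cell_sum m c (\<lambda>j. X j \<omega>) \<in> B} \<in> events"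
proof -
  have "{x \<in> space (\<Pi>\<^sub>M j\<in>{..<m}. haar p). carry m c x = e \<and> cell_sum m c x \<in> B} \<in> sets (\<Pi>\<^sub>M j\<in>{..<m}. haar p)"
    by measurable
  from measurable_sets_Collect[OF X_vector_measurable this]
  show ?thesis
    using measurable_space[OF X_vector_measurable]
    by (simp add: cell_sum_restrict carry_restrict conj_commute cong: conj_cong)
qed

text \<open>The target set B may depend on the carry. A constant B gives the law of the rounded sum,
  a translated B the law of the rounded value of the true sum.\<close>

lemma prob_eq_sum_carries:
  "prob {\<omega> \<in> space M. cell_sum m c (\<lambda>j. X j \<omega>) \<in> B (carry m c (\<lambda>j. X j \<omega>))}
    = (\<Sum>e\<in>carries p m c. prob {\<omega> \<in> space M. carry m c (\<lambda>j. X j \<omega>) = e \<and> cell_sum m c (\<lambda>j. X j \<omega>) \<in> B e})"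
proof -
  have union: "{\<omega> \<in> space M. cell_sum m c (\<lambda>j. X j \<omega>) \<in> B (carry m c (\<lambda>j. X j \<omega>))}
      = (\<Union>e\<in>carries p m c. {\<omega> \<in> space M. carry m c (\<lambda>j. X j \<omega>) = e \<and> cell_sum m c (\<lambda>j. X j \<omega>) \<in> B e})"
    using carry_in_carries by blast
  show ?thesis
    unfolding union
  proof (rule finite_measure_finite_Union[OF finite_carries])
    show "(\<lambda>e. {\<omega> \<in> space M. carry m c (\<lambda>j. X j \<omega>) = e \<and> cell_sum m c (\<lambda>j. X j \<omega>) \<in> B e}) ` carries p m c \<subseteq> events"
      by (rule image_subsetI) (rule events_carry_cell_sum)
    show "disjoint_family_on (\<lambda>e. {\<omega> \<in> space M. carry m c (\<lambda>j. X j \<omega>) = e \<and> cell_sum m c (\<lambda>j. X j \<omega>) \<in> B e}) (carries p m c)"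
      unfolding disjoint_family_on_def by blast
  qed
qed

lemma cell_torus_lincomb_X:
  "\<omega> \<in> space M \<Longrightarrow> cell (torus_lincomb p m c (\<lambda>j. X j \<omega>))
    = (cell_sum m c (\<lambda>j. X j \<omega>) + code (carry m c (\<lambda>j. X j \<omega>))) mod order"
  using X_torus by (intro cell_torus_lincomb) auto

text \<open>Translating every \<open>X\<^sub>j\<close> by \<open>b\<^sub>j e\<close>, where \<open>\<Sum>j. c\<^sub>j b\<^sub>j = 1\<close>, adds \<open>e\<close> to the sum of the cells
  without changing the carry. So the correlation between carry and sum is harmless.\<close>

lemma prob_cell_close:
  fixes \<delta> :: real
  assumes b: "(\<Sum>j<m. c j * b j) = 1"
    and close: "\<And>e j. e \<in> carries p m c \<Longrightarrow> j < m \<Longrightarrow> tv_close (distr M (haar p) (X j))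
      (distr (distr M (haar p) (X j)) (haar p) (shift (\<lambda>i. b j * e i))) \<delta>"
  shows "\<bar>prob {\<omega> \<in> space M. cell_sum m c (\<lambda>j. X j \<omega>) \<in> B}
      - prob {\<omega> \<in> space M. cell (torus_lincomb p m c (\<lambda>j. X j \<omega>)) \<in> B}\<bar>
    \<le> card (carries p m c) * (m * \<delta>)"
proof -
  define S where "S e = {\<omega> \<in> space M. carry m c (\<lambda>j. X j \<omega>) = e \<and> cell_sum m c (\<lambda>j. X j \<omega>) \<in> B}" for e
  define A where "A e = {\<omega> \<in> space M. carry m c (\<lambda>j. X j \<omega>) = e
    \<and> cell_sum m c (\<lambda>j. X j \<omega>) \<in> {s. (s + code e) mod order \<in> B}}" for e
  have S: "prob {\<omega> \<in> space M. cell_sum m c (\<lambda>j. X j \<omega>) \<in> B} = (\<Sum>e\<in>carries p m c. prob (S e))"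
    unfolding S_def by (rule prob_eq_sum_carries)
  have "{\<omega> \<in> space M. cell (torus_lincomb p m c (\<lambda>j. X j \<omega>)) \<in> B}
      = {\<omega> \<in> space M. cell_sum m c (\<lambda>j. X j \<omega>) \<in> {s. (s + code (carry m c (\<lambda>j. X j \<omega>))) mod order \<in> B}}"
    using cell_torus_lincomb_X by auto
  hence A: "prob {\<omega> \<in> space M. cell (torus_lincomb p m c (\<lambda>j. X j \<omega>)) \<in> B} = (\<Sum>e\<in>carries p m c. prob (A e))"
    unfolding A_def using prob_eq_sum_carries[of c "\<lambda>e. {s. (s + code e) mod order \<in> B}"] by simp
  have "\<bar>prob (S e) - prob (A e)\<bar> \<le> m * \<delta>" if e: "e \<in> carries p m c" for e
  proof -
    \<comment> \<open>One event on the product space: the original vector lies in it exactly on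
      \<open>S e\<close>, the translated vector exactly on \<open>A e\<close>. So m exchanges of
      marginals bound the difference.\<close>
    define \<Psi> where "\<Psi> = {x \<in> space (\<Pi>\<^sub>M j\<in>{..<m}. haar p). carry m c x = e \<and> cell_sum m c x \<in> B}"
    let ?g = "\<lambda>j. shift (\<lambda>i. b j * e i)"
    have g: "?g j \<in> haar p \<rightarrow>\<^sub>M haar p" for j unfolding shift_def by measurable
    have "\<Psi> \<in> sets (\<Pi>\<^sub>M j\<in>{..<m}. haar p)" unfolding \<Psi>_def by measurable
    hence "\<bar>prob {\<omega> \<in> space M. (\<lambda>j\<in>{..<m}. X j \<omega>) \<in> \<Psi>} - prob {\<omega> \<in> space M. (\<lambda>j\<in>{..<m}. ?g j (X j \<omega>)) \<in> \<Psi>}\<bar>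
        \<le> card {..<m} * \<delta>"
      using close[OF e] m_pos by (intro indep_vars_tv_close[OF indep] g) auto
    moreover have "{\<omega> \<in> space M. (\<lambda>j\<in>{..<m}. X j \<omega>) \<in> \<Psi>} = S e"
      unfolding \<Psi>_def S_def using measurable_space[OF X_vector_measurable]
      by (auto simp: cell_sum_restrict carry_restrict)
    moreover have "{\<omega> \<in> space M. (\<lambda>j\<in>{..<m}. ?g j (X j \<omega>)) \<in> \<Psi>} = A e"
    proof -
      have "(\<lambda>j\<in>{..<m}. ?g j (X j \<omega>)) \<in> \<Psi> \<longleftrightarrow> carry m c (\<lambda>j. X j \<omega>) = e
          \<and> (cell_sum m c (\<lambda>j. X j \<omega>) + code e) mod order \<in> B" if \<omega>: "\<omega> \<in> space M" for \<omega>
      proof -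
        have "(\<lambda>j\<in>{..<m}. ?g j (X j \<omega>)) \<in> space (\<Pi>\<^sub>M j\<in>{..<m}. haar p)"
          unfolding space_PiM
        proof (rule restrict_PiE_iff[THEN iffD2], rule ballI)
          fix j assume "j \<in> {..<m}"
          hence "X j \<omega> \<in> space (haar p)" using measurable_space[OF X_measurable \<omega>] by auto
          thus "?g j (X j \<omega>) \<in> space (haar p)" by (rule measurable_space[OF g])
        qed
        thus ?thesis
          unfolding \<Psi>_def using X_torus[OF _ \<omega>] b
          by (simp add: cell_sum_restrict carry_restrict carry_shift cell_sum_shift)
      qed
      thus ?thesis unfolding A_def by auto
    qed
    ultimately show ?thesis by simp
  qed
  hence "(\<Sum>e\<in>carries p m c. \<bar>prob (S e) - prob (A e)\<bar>) \<le> (\<Sum>e\<in>carries p m c. m * \<delta>)"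
    by (rule sum_mono)
  moreover have "\<bar>(\<Sum>e\<in>carries p m c. prob (S e)) - (\<Sum>e\<in>carries p m c. prob (A e))\<bar>
      \<le> (\<Sum>e\<in>carries p m c. \<bar>prob (S e) - prob (A e)\<bar>)"
    unfolding sum_subtractf[symmetric] by (rule sum_abs)
  ultimately show ?thesis unfolding S A by simp
qed

lemma events_cell_torus_lincomb:
  "{\<omega> \<in> space M. cell (torus_lincomb p m c (\<lambda>j. X j \<omega>)) = t} \<in> events"
proof -
  have "{\<omega> \<in> space M. cell (torus_lincomb p m c (\<lambda>j. X j \<omega>)) = t}
      = (\<Union>e\<in>carries p m c. {\<omega> \<in> space M. carry m c (\<lambda>j. X j \<omega>) = e
          \<and> cell_sum m c (\<lambda>j. X j \<omega>) \<in> {s. (s + code e) mod order = t}})"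
    using carry_in_carries by (auto simp: cell_torus_lincomb_X)
  also have "\<dots> \<in> events"
    by (intro sets.finite_UN finite_carries events_carry_cell_sum)
  finally show ?thesis .
qed

text \<open>Where the rounded sum is s and the carry is e, the cell of the true sum is s + code e;
  the condition on the carry is then dropped. This holds exactly on every grid, without any
  limit.\<close>

lemma cell_sum_prob_dominated:
  "cell_sum_prob c s \<le> (\<Sum>e\<in>carries p m c.
    prob {\<omega> \<in> space M. cell (torus_lincomb p m c (\<lambda>j. X j \<omega>)) = (s + code e) mod order})"
proof -
  have "cell_sum_prob c s = (\<Sum>e\<in>carries p m c.
      prob {\<omega> \<in> space M. carry m c (\<lambda>j. X j \<omega>) = e \<and> cell_sum m c (\<lambda>j. X j \<omega>) \<in> {s}})"
    using prob_eq_sum_carries[of c "\<lambda>_. {s}"] by (simp add: cell_sum_prob_def)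
  also have "\<dots> \<le> (\<Sum>e\<in>carries p m c.
      prob {\<omega> \<in> space M. cell (torus_lincomb p m c (\<lambda>j. X j \<omega>)) = (s + code e) mod order})"
    by (intro sum_mono finite_measure_mono events_cell_torus_lincomb) (auto simp: cell_torus_lincomb_X)
  finally show ?thesis .
qed

lemma measurable_cell_sum_X:
  "(\<lambda>\<omega>. cell_sum m c (\<lambda>j. X j \<omega>)) \<in> M \<rightarrow>\<^sub>M count_space UNIV"
  using measurable_compose[OF X_vector_measurable measurable_cell_sum]
  by (simp add: cell_sum_restrict)

lemma cell_sum_range: "cell_sum m c x \<in> {0..<int order}"
  using order_pos by (simp add: cell_sum_def)

text \<open>Rescaling t log t by the order K produces log K times the total mass, which is
  1.\<close>

lemma entropy_cell_sum:
  "entropy 2 (count_space UNIV) (\<lambda>\<omega>. cell_sum m c (\<lambda>j. X j \<omega>))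
    = log 2 order - (\<Sum>s\<in>{0..<int order}. xlogx (order * cell_sum_prob c s)) / order"
proof -
  have total: "(\<Sum>s\<in>{0..<int order}. cell_sum_prob c s) = 1"
  proof -
    have "(\<Sum>s\<in>{0..<int order}. cell_sum_prob c s)
        = prob (\<Union>s\<in>{0..<int order}. {\<omega> \<in> space M. cell_sum m c (\<lambda>j. X j \<omega>) = s})"
      unfolding cell_sum_prob_def
    proof (rule finite_measure_finite_Union[symmetric])
      have "{\<omega> \<in> space M. cell_sum m c (\<lambda>j. X j \<omega>) = s} \<in> events" for s
        using measurable_cell_sum_X by measurable
      thus "(\<lambda>s. {\<omega> \<in> space M. cell_sum m c (\<lambda>j. X j \<omega>) = s}) ` {0..<int order} \<subseteq> events" by blast
    qed (auto simp: disjoint_family_on_def)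
    also have "(\<Union>s\<in>{0..<int order}. {\<omega> \<in> space M. cell_sum m c (\<lambda>j. X j \<omega>) = s}) = space M"
      using cell_sum_range by blast
    finally show ?thesis by (simp add: prob_space)
  qed
  have "xlogx (order * r) / order = r * log 2 order + xlogx r" if "0 \<le> r" for r :: real
    using that order_pos by (cases "r = 0") (auto simp: xlogx_def log_mult field_simps)
  hence "(\<Sum>s\<in>{0..<int order}. xlogx (order * cell_sum_prob c s)) / order
      = (\<Sum>s\<in>{0..<int order}. cell_sum_prob c s * log 2 order + xlogx (cell_sum_prob c s))"
    by (simp add: sum_divide_distrib cell_sum_prob_def)
  also have "\<dots> = log 2 order + (\<Sum>s\<in>{0..<int order}. xlogx (cell_sum_prob c s))"
    by (simp add: sum.distrib total flip: sum_distrib_right)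
  finally show ?thesis
    using entropy_finite_range[OF measurable_cell_sum_X, where S = "{0..<int order}"] cell_sum_range
    by (simp add: cell_sum_prob_def)
qed

end

section \<open>Refinement of the grid\<close>

lemma eventually_prime_moduli_fine:
  fixes v :: "nat \<Rightarrow> real"
  assumes "0 < \<delta>"
  shows "\<forall>\<^sub>F N in sequentially. \<forall>i<p. \<bar>2 * pi * (v i / prime_moduli N i)\<bar> < \<delta>"
proof -
  have "\<forall>\<^sub>F N in sequentially. \<bar>2 * pi * (v i / prime_moduli N i)\<bar> < \<delta>" for i
  proof -
    obtain N0 where N0: "2 * pi * \<bar>v i\<bar> / \<delta> < real N0" using reals_Archimedean2 by blast
    have "\<bar>2 * pi * (v i / prime_moduli N i)\<bar> < \<delta>" if N: "N \<ge> N0" for N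
    proof -
      have "real N0 \<le> prime_moduli N i" using prime_moduli_ge[of N i] N by linarith
      hence "2 * pi * \<bar>v i\<bar> / \<delta> < prime_moduli N i" using N0 by linarith
      moreover have "0 < real (prime_moduli N i)" using prime_gt_0_nat[OF prime_prime_moduli] by simp
      ultimately have "2 * pi * \<bar>v i\<bar> / prime_moduli N i < \<delta>"
        using assms by (simp add: field_simps)
      thus ?thesis by (simp add: abs_mult)
    qed
    thus ?thesis by (auto simp: eventually_sequentially)
  qed
  hence "\<forall>\<^sub>F N in sequentially. \<forall>i\<in>{..<p}. \<bar>2 * pi * (v i / prime_moduli N i)\<bar> < \<delta>"
    by (intro eventually_ball_finite) auto
  thus ?thesis by (simp add: Ball_def)
qed

lemma uc_approximable_haar: "integrable (haar p) u \<Longrightarrow> uc_approximable {..<p} (haar p) u"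
proof -
  interpret prob_space "haar p" by (rule prob_space_haar)
  interpret finite_measure_PiM_borel "haar p" "{..<p}"
    by unfold_locales (auto simp: sets_haar)
  show "integrable (haar p) u \<Longrightarrow> uc_approximable {..<p} (haar p) u"
    by (rule uc_approximable_integrable)
qed

text \<open>The grid vector w is fixed while the moduli grow, so the rotation angles w_i / k_i tend
  to 0; the Radon-Nikodym density is approximated up to \<epsilon> / 3 to pay for the three
  exchanges.\<close>

lemma eventually_tv_close_shift:
  assumes \<mu>: "prob_space \<mu>" "sets \<mu> = sets (haar p)" "absolutely_continuous (haar p) \<mu>" and \<epsilon>: "0 < \<epsilon>"
  shows "\<forall>\<^sub>F N in sequentially. tv_close \<mu> (distr \<mu> (haar p) (coprime_grid.shift p (prime_moduli N) w)) \<epsilon>"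
proof -
  interpret H: prob_space "haar p" by (rule prob_space_haar)
  interpret \<mu>: prob_space \<mu> by (rule \<mu>(1))
  obtain u where u: "u \<in> borel_measurable (haar p)" "AE x in haar p. RN_deriv (haar p) \<mu> x = ennreal (u x)"
      "\<And>x. 0 \<le> u x"
    using H.real_RN_deriv[OF \<mu>.finite_measure_axioms \<mu>(3,2)] by metis
  have "\<mu> = density (haar p) (RN_deriv (haar p) \<mu>)"
    using H.density_RN_deriv[OF \<mu>(3,2)] by simp
  also have "\<dots> = density (haar p) (\<lambda>x. ennreal (u x))"
    using u by (intro density_cong) auto
  finally have dens: "\<mu> = density (haar p) (\<lambda>x. ennreal (u x))" .
  have "(\<integral>\<^sup>+x. ennreal (u x) \<partial>haar p) = emeasure \<mu> (space \<mu>)"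
    using u(1) by (subst (2) dens, subst dens) (simp add: emeasure_density cong: nn_integral_cong)
  hence "integrable (haar p) u"
    using u \<mu>.emeasure_space_1 by (intro integrableI_nonneg) auto
  note int = this
  obtain v \<delta> where v: "integrable (haar p) v" "0 < \<delta>"
      "\<And>x y. (\<And>i. i \<in> {..<p} \<Longrightarrow> dist (x i) (y i) < \<delta>) \<Longrightarrow> \<bar>v x - v y\<bar> \<le> \<epsilon> / 3"
      "(\<integral>x. \<bar>u x - v x\<bar> \<partial>haar p) \<le> \<epsilon> / 3"
    using uc_approximableE[OF uc_approximable_haar[OF int], of "\<epsilon> / 3"] \<epsilon> by auto
  show ?thesis
    using eventually_prime_moduli_fine[OF v(2), of p "\<lambda>i. real_of_int (w i)"]
  proof eventually_elim
    case (elim N)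
    interpret coprime_grid p "prime_moduli N" by (rule coprime_grid_prime_moduli)
    have "tv_close \<mu> (distr \<mu> (haar p) (rotation p (\<lambda>i. w i / prime_moduli N i))) (3 * (\<epsilon> / 3))"
      by (rule tv_close_rotate[OF u(1,3) dens int v(1) _ v(4)]) (use v(3) elim in auto)
    thus ?case by (simp add: shift_def)
  qed
qed

lemma entropy_cell_sum_tendsto:
  fixes M :: "'a measure" and X :: "nat \<Rightarrow> 'a \<Rightarrow> nat \<Rightarrow> complex"
  assumes M: "prob_space M"
    and indep: "prob_space.indep_vars M (\<lambda>_. haar p) X {..<m}"
    and X_torus: "\<forall>j<m. \<forall>\<omega>\<in>space M. X j \<omega> \<in> torus p"
    and X_ac: "\<forall>j<m. absolutely_continuous (haar p) (distr M (haar p) (X j))"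
    and c: "Gcd (c ` {..<m}) = (1 :: int)"
    and ent: "information_space.finite_entropy M 2 (haar p) (\<lambda>\<omega>. torus_lincomb p m c (\<lambda>j. X j \<omega>)) f"
  shows "(\<lambda>N. prob_space.entropy M 2 (count_space UNIV)
            (\<lambda>\<omega>. coprime_grid.cell_sum p (prime_moduli N) m c (\<lambda>j. X j \<omega>))
          - log 2 (coprime_grid.order p (prime_moduli N)))
    \<longlonglongrightarrow> prob_space.entropy M 2 (haar p) (\<lambda>\<omega>. torus_lincomb p m c (\<lambda>j. X j \<omega>))"
proof -
  interpret prob_space M by (rule M)
  interpret information_space M 2 by unfold_locales simp
  \<comment> \<open>The Gcd of the empty set is 0, not 1.\<close>
  have m_pos: "0 < m" using c by (cases m) auto
  let ?Y = "\<lambda>\<omega>. torus_lincomb p m c (\<lambda>j. X j \<omega>)"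
  have vars: "torus_variables M p (prime_moduli N) m X" for N
  proof -
    interpret coprime_grid p "prime_moduli N" by (rule coprime_grid_prime_moduli)
    show ?thesis by unfold_locales (use indep X_torus m_pos in auto)
  qed
  have dist: "distributed M (haar p) ?Y f" and f_xlogx: "integrable (haar p) (\<lambda>x. xlogx (f x))"
    and f_nonneg: "\<And>x. x \<in> space (haar p) \<Longrightarrow> 0 \<le> f x"
    using ent by (auto simp: finite_entropy_def xlogx_def)
  have f_int: "integrable (haar p) f"
  proof -
    have "f \<in> borel_measurable (haar p)" using distributed_real_measurable[OF f_nonneg dist] .
    moreover have "(\<integral>\<^sup>+x. ennreal (f x) \<partial>haar p) = 1"
      using distributed_nn_integral[OF dist, of "\<lambda>_. 1"] by (simp add: emeasure_space_1)
    ultimately show ?thesis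
      using f_nonneg by (intro integrableI_nonneg) auto
  qed
  obtain b where b: "(\<Sum>j<m. c j * b j) = 1" using bezout_int_family[of c m] c by metis
  define K where "K N = coprime_grid.order p (prime_moduli N)" for N
  define cl where "cl N = coprime_grid.cell p (prime_moduli N)" for N
  define r where "r N = torus_variables.cell_sum_prob M p (prime_moduli N) m X c" for N
  have part: "uniform_partition (haar p) (K N) (cl N)" for N
    unfolding K_def cl_def
    by (rule coprime_grid.uniform_partition_cell) (rule coprime_grid_prime_moduli)
  \<comment> \<open>This links the two languages: integrals of the density over cells are the law of
    the rounded true sum.\<close>
  have q: "uniform_partition.cell_integral (haar p) (cl N) f s = prob {\<omega> \<in> space M. cl N (?Y \<omega>) = s}" for N s
  proof -
    interpret U: uniform_partition "haar p" "K N" "cl N" by (rule part)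
    have "U.cell_integral f s = (\<integral>\<omega>. indicator {s} (cl N (?Y \<omega>)) \<partial>M)"
      unfolding U.cell_integral_def
    proof (rule distributed_integral[OF dist _ f_nonneg])
      show "(\<lambda>x. indicator {s} (cl N x) :: real) \<in> borel_measurable (haar p)"
        by (rule measurable_compose[OF U.cell_measurable]) simp
    qed
    also have "\<dots> = (\<integral>\<omega>. indicator {\<omega> \<in> space M. cl N (?Y \<omega>) = s} \<omega> \<partial>M)"
      by (intro Bochner_Integration.integral_cong) (auto simp: indicator_def)
    finally show ?thesis by (simp add: Int_absorb2 Collect_restrict)
  qed
  have "(\<lambda>N. (\<Sum>s\<in>{0..<int (K N)}. xlogx (K N * r N s)) / K N) \<longlonglongrightarrow> (\<integral>x. xlogx (f x) \<partial>haar p)"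
  \<comment> \<open>The dominating laws are indexed by the carries, and \<sigma> is translation by
    the code of a carry in the cyclic group.\<close>
  proof (rule xlogx_sum_tendsto[OF part f_int f_nonneg f_xlogx finite_carries[of p m c] carries_nonempty,
        where \<sigma> = "\<lambda>N e s. (s + coprime_grid.code p (prime_moduli N) e) mod int (K N)"])
    fix N e
    interpret torus_variables M p "prime_moduli N" m X by (rule vars)
    show "bij_betw (\<lambda>s. (s + code e) mod int (K N)) {0..<int (K N)} {0..<int (K N)}"
    proof (rule bij_betw_byWitness[where f' = "\<lambda>s. (s - code e) mod int (K N)"])
    qed (use order_pos in \<open>auto simp: K_def mod_diff_left_eq mod_add_left_eq\<close>)
  next
    fix N s
    interpret torus_variables M p "prime_moduli N" m X by (rule vars)
    show "0 \<le> r N s" by (simp add: r_def cell_sum_prob_def)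
    show "r N s \<le> (\<Sum>e\<in>carries p m c.
        uniform_partition.cell_integral (haar p) (cl N) f ((s + code e) mod int (K N)))"
      unfolding q unfolding r_def cl_def K_def by (rule cell_sum_prob_dominated)
  next
    show "(\<lambda>N. \<integral>x. \<bar>f x - K N * uniform_partition.cell_integral (haar p) (cl N) f (cl N x)\<bar> \<partial>haar p) \<longlonglongrightarrow> 0"
    proof (rule tendstoI)
      fix \<epsilon> :: real assume \<epsilon>: "0 < \<epsilon>"
      \<comment> \<open>An error \<epsilon> / 5 becomes 4 \<epsilon> / 5 after averaging over cells,
        which is still below \<epsilon>.\<close>
      obtain v \<delta> where v: "integrable (haar p) v" "0 < \<delta>"
          "\<And>x y. (\<And>i. i \<in> {..<p} \<Longrightarrow> dist (x i) (y i) < \<delta>) \<Longrightarrow> \<bar>v x - v y\<bar> \<le> \<epsilon> / 5"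
          "(\<integral>x. \<bar>f x - v x\<bar> \<partial>haar p) \<le> \<epsilon> / 5"
        using uc_approximableE[OF uc_approximable_haar[OF f_int], of "\<epsilon> / 5"] \<epsilon> by auto
      show "\<forall>\<^sub>F N in sequentially.
          dist (\<integral>x. \<bar>f x - K N * uniform_partition.cell_integral (haar p) (cl N) f (cl N x)\<bar> \<partial>haar p) 0 < \<epsilon>"
        using eventually_prime_moduli_fine[OF v(2), of p "\<lambda>_. 1"]
      proof eventually_elim
        case (elim N)
        interpret coprime_grid p "prime_moduli N" by (rule coprime_grid_prime_moduli)
        have "(\<integral>x. \<bar>f x - K N * haar.cell_integral f (cl N x)\<bar> \<partial>haar p) \<le> 4 * (\<epsilon> / 5)"
          unfolding K_def cl_def
          by (rule cell_average_close[OF f_int v(1) _ v(4)]) (use v(3) elim in auto)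
        thus ?case using \<epsilon> by (simp add: cl_def)
      qed
    qed
    show "(\<lambda>N. \<Sum>s\<in>{0..<int (K N)}. \<bar>r N s - uniform_partition.cell_integral (haar p) (cl N) f s\<bar>) \<longlonglongrightarrow> 0"
    proof (rule tendstoI)
      fix \<epsilon> :: real assume \<epsilon>: "0 < \<epsilon>"
      define C where "C = real (card (carries p m c)) * m"
      have C: "0 < C"
        using m_pos finite_carries carries_nonempty by (simp add: C_def card_gt_0_iff)
      \<comment> \<open>C counts pairs of a carry and a variable, each costing \<eta>; passing from
        events to the l^1 distance doubles C \<eta> to 2 \<epsilon> / 3.\<close>
      define \<eta> where "\<eta> = \<epsilon> / (3 * C)"
      have \<eta>: "0 < \<eta>" "C * \<eta> = \<epsilon> / 3" using \<epsilon> C by (auto simp: \<eta>_def)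
      have "\<forall>\<^sub>F N in sequentially. tv_close (distr M (haar p) (X j)) (distr (distr M (haar p) (X j)) (haar p)
          (coprime_grid.shift p (prime_moduli N) (\<lambda>i. b j * e i))) \<eta>" if j: "j < m" for j e
      proof -
        interpret torus_variables M p "prime_moduli 0" m X by (rule vars)
        show ?thesis
          using X_ac j X_measurable[OF j] \<eta> by (intro eventually_tv_close_shift prob_space_distr) auto
      qed
      \<comment> \<open>Finitely many translations are involved, the same for all N, so one
        threshold serves them all.\<close>
      hence "\<forall>\<^sub>F N in sequentially. \<forall>e\<in>carries p m c. \<forall>j\<in>{..<m}.
          tv_close (distr M (haar p) (X j)) (distr (distr M (haar p) (X j)) (haar p)
          (coprime_grid.shift p (prime_moduli N) (\<lambda>i. b j * e i))) \<eta>"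
        by (intro eventually_ball_finite finite_carries ballI) auto
      thus "\<forall>\<^sub>F N in sequentially.
          dist (\<Sum>s\<in>{0..<int (K N)}. \<bar>r N s - uniform_partition.cell_integral (haar p) (cl N) f s\<bar>) 0 < \<epsilon>"
      proof eventually_elim
        case (elim N)
        interpret torus_variables M p "prime_moduli N" m X by (rule vars)
        have "(\<Sum>s\<in>{0..<int (K N)}. \<bar>r N s - uniform_partition.cell_integral (haar p) (cl N) f s\<bar>)
            \<le> 2 * (card (carries p m c) * (m * \<eta>))"
        proof (rule sum_abs_diff_le)
          fix B assume B: "B \<subseteq> {0..<int (K N)}"
          hence fin: "finite B" by (rule finite_subset) simp
          have "(\<Sum>s\<in>B. r N s) = prob (\<Union>s\<in>B. {\<omega> \<in> space M. cell_sum m c (\<lambda>j. X j \<omega>) = s})"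
            unfolding r_def cell_sum_prob_def
          proof (rule finite_measure_finite_Union[OF fin, symmetric])
            have "{\<omega> \<in> space M. cell_sum m c (\<lambda>j. X j \<omega>) = s} \<in> events" for s
              using measurable_cell_sum_X by measurable
            thus "(\<lambda>s. {\<omega> \<in> space M. cell_sum m c (\<lambda>j. X j \<omega>) = s}) ` B \<subseteq> events" by blast
          qed (auto simp: disjoint_family_on_def)
          also have "(\<Union>s\<in>B. {\<omega> \<in> space M. cell_sum m c (\<lambda>j. X j \<omega>) = s})
              = {\<omega> \<in> space M. cell_sum m c (\<lambda>j. X j \<omega>) \<in> B}" by auto
          finally have 1: "(\<Sum>s\<in>B. r N s) = prob {\<omega> \<in> space M. cell_sum m c (\<lambda>j. X j \<omega>) \<in> B}" .
          have "(\<Sum>s\<in>B. uniform_partition.cell_integral (haar p) (cl N) f s)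
              = prob (\<Union>s\<in>B. {\<omega> \<in> space M. cl N (?Y \<omega>) = s})"
            unfolding q
          proof (rule finite_measure_finite_Union[OF fin, symmetric])
            show "(\<lambda>s. {\<omega> \<in> space M. cl N (?Y \<omega>) = s}) ` B \<subseteq> events"
              unfolding cl_def using events_cell_torus_lincomb by blast
          qed (auto simp: disjoint_family_on_def)
          also have "(\<Union>s\<in>B. {\<omega> \<in> space M. cl N (?Y \<omega>) = s}) = {\<omega> \<in> space M. cell (?Y \<omega>) \<in> B}"
            by (auto simp: cl_def)
          finally have 2: "(\<Sum>s\<in>B. uniform_partition.cell_integral (haar p) (cl N) f s)
              = prob {\<omega> \<in> space M. cell (?Y \<omega>) \<in> B}" .
          show "\<bar>(\<Sum>s\<in>B. r N s) - (\<Sum>s\<in>B. uniform_partition.cell_integral (haar p) (cl N) f s)\<bar>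
              \<le> card (carries p m c) * (m * \<eta>)"
            unfolding 1 2 using elim by (intro prob_cell_close[OF b]) auto
        qed simp
        also have "2 * (card (carries p m c) * (m * \<eta>)) = 2 * (\<epsilon> / 3)"
          using \<eta>(2) by (simp add: C_def mult_ac)
        also have "\<dots> < \<epsilon>" using \<epsilon> by simp
        finally show ?case by (simp add: sum_nonneg)
      qed
    qed
  qed
  hence "(\<lambda>N. - ((\<Sum>s\<in>{0..<int (K N)}. xlogx (K N * r N s)) / K N)) \<longlonglongrightarrow> - (\<integral>x. xlogx (f x) \<partial>haar p)"
    by (rule tendsto_minus)
  moreover have "entropy 2 (count_space UNIV)
      (\<lambda>\<omega>. coprime_grid.cell_sum p (prime_moduli N) m c (\<lambda>j. X j \<omega>)) - log 2 (K N)
      = - ((\<Sum>s\<in>{0..<int (K N)}. xlogx (K N * r N s)) / K N)" for N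
    using torus_variables.entropy_cell_sum[OF vars] by (simp add: K_def r_def)
  moreover have "entropy 2 (haar p) ?Y = - (\<integral>x. xlogx (f x) \<partial>haar p)"
    using entropy_distr[OF dist f_nonneg] by (simp add: xlogx_def)
  ultimately show ?thesis by (simp add: K_def)
qed

text \<open>The cyclic hypothesis is available only on probability spaces of type nat \<Rightarrow>
  int. Entropy and independence depend on joint laws alone, so the vector of cells is moved to its
  canonical space, where the coordinates play the role of the Z_j.\<close>

lemma (in coprime_grid) cell_sum_ineq:
  fixes M :: "'a measure" and X :: "nat \<Rightarrow> 'a \<Rightarrow> nat \<Rightarrow> complex" and a :: "nat \<Rightarrow> nat \<Rightarrow> int"
  assumes M: "prob_space M" and indep: "prob_space.indep_vars M (\<lambda>_. haar p) X {..<m}" and "0 < m"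
    and cyclic: "\<And>(N :: (nat \<Rightarrow> int) measure) (Z :: nat \<Rightarrow> (nat \<Rightarrow> int) \<Rightarrow> int).
      prob_space N \<Longrightarrow> prob_space.indep_vars N (\<lambda>_. count_space UNIV) Z {..<m} \<Longrightarrow>
      (\<forall>j<m. \<forall>\<omega>\<in>space N. Z j \<omega> \<in> {0..<int order}) \<Longrightarrow>
      (\<Sum>i<n. \<alpha> i * prob_space.entropy N 2 (count_space UNIV) (\<lambda>\<omega>. (\<Sum>j<m. a i j * Z j \<omega>) mod int order)) \<le> 0"
  shows "(\<Sum>i<n. \<alpha> i * prob_space.entropy M 2 (count_space UNIV) (\<lambda>\<omega>. cell_sum m (a i) (\<lambda>j. X j \<omega>))) \<le> 0"
proof -
  interpret M: prob_space M by (rule M)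
  let ?CS = "\<Pi>\<^sub>M j\<in>{..<m}. count_space (UNIV :: int set)"
  let ?V = "\<lambda>\<omega>. \<lambda>j\<in>{..<m}. cell (X j \<omega>)"
  define N where "N = distr M ?CS ?V"
  \<comment> \<open>The canonical space also contains vectors out of range. The reduction forces the
    range condition at every point and changes nothing on actual cells.\<close>
  define Z where "Z j \<omega> = \<omega> j mod int order" for j and \<omega> :: "nat \<Rightarrow> int"
  have cX: "(\<lambda>\<omega>. cell (X j \<omega>)) \<in> M \<rightarrow>\<^sub>M count_space UNIV" if "j < m" for j
    using indep that by (intro measurable_compose[OF _ measurable_cell]) (auto simp: M.indep_vars_def)
  have V: "?V \<in> M \<rightarrow>\<^sub>M ?CS" by (rule measurable_restrict) (simp add: cX)
  have N: "prob_space N" unfolding N_def by (rule M.prob_space_distr[OF V])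
  interpret N: prob_space N by (rule N)
  have distr_N: "distr N (count_space UNIV) g = distr M (count_space UNIV) (\<lambda>\<omega>. g (?V \<omega>))"
    for g :: "(nat \<Rightarrow> int) \<Rightarrow> int"
    unfolding N_def using measurable_PiM_count_space[of "{..<m}" g] V
    by (subst distr_distr) (auto simp: comp_def)
  have Z_V: "Z j (?V \<omega>) = cell (X j \<omega>)" if "j < m" for j \<omega>
    using that cell_range[of "X j \<omega>"] by (simp add: Z_def)
  have Z_meas: "Z j \<in> N \<rightarrow>\<^sub>M count_space UNIV" for j
    unfolding N_def using measurable_PiM_count_space[of "{..<m}" "Z j"] by simp
  have ne: "{..<m} \<noteq> {}" using \<open>0 < m\<close> by auto
  have law: "distr M ?CS ?V = (\<Pi>\<^sub>M j\<in>{..<m}. distr M (count_space UNIV) (\<lambda>\<omega>. cell (X j \<omega>)))"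
  proof -
    have "M.indep_vars (\<lambda>_. count_space UNIV) (\<lambda>j \<omega>. cell (X j \<omega>)) {..<m}"
      by (rule M.indep_vars_compose2[OF indep]) (rule measurable_cell)
    thus ?thesis
      using cX by (subst (asm) M.indep_vars_iff_distr_eq_PiM'[OF ne]) auto
  qed
  have "N.indep_vars (\<lambda>_. count_space UNIV) Z {..<m}"
  proof (subst N.indep_vars_iff_distr_eq_PiM'[OF ne])
    have "distr N ?CS (\<lambda>\<omega>. \<lambda>j\<in>{..<m}. Z j \<omega>) = distr M ?CS (\<lambda>\<omega>. \<lambda>j\<in>{..<m}. Z j (?V \<omega>))"
      unfolding N_def using V measurable_PiM_count_space
      by (subst distr_distr) (auto simp: comp_def intro!: measurable_restrict)
    also have "(\<lambda>\<omega>. \<lambda>j\<in>{..<m}. Z j (?V \<omega>)) = ?V"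
      using Z_V by (intro ext) (simp add: restrict_def)
    also have "distr M ?CS ?V = (\<Pi>\<^sub>M j\<in>{..<m}. distr N (count_space UNIV) (Z j))"
      unfolding law distr_N by (rule PiM_cong[OF refl]) (simp only: Z_V lessThan_iff)
    finally show "distr N ?CS (\<lambda>\<omega>. \<lambda>j\<in>{..<m}. Z j \<omega>) = (\<Pi>\<^sub>M j\<in>{..<m}. distr N (count_space UNIV) (Z j))" .
  qed (rule Z_meas)
  moreover have "\<forall>j<m. \<forall>\<omega>\<in>space N. Z j \<omega> \<in> {0..<int order}"
    using order_pos by (simp add: Z_def)
  ultimately have "(\<Sum>i<n. \<alpha> i * N.entropy 2 (count_space UNIV) (\<lambda>\<omega>. (\<Sum>j<m. a i j * Z j \<omega>) mod int order)) \<le> 0"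
    by (rule cyclic[OF N])
  moreover have "N.entropy 2 (count_space UNIV) (\<lambda>\<omega>. (\<Sum>j<m. a i j * Z j \<omega>) mod int order)
      = M.entropy 2 (count_space UNIV) (\<lambda>\<omega>. cell_sum m (a i) (\<lambda>j. X j \<omega>))" for i
    unfolding N.entropy_def M.entropy_def distr_N by (simp add: cell_sum_def Z_V)
  ultimately show ?thesis by simp
qed

theorem mainTheorem15:
  fixes n m p :: nat
    and a :: "nat \<Rightarrow> nat \<Rightarrow> int"
    and \<alpha> :: "nat \<Rightarrow> real"
    and M :: "'a measure"
    and X :: "nat \<Rightarrow> 'a \<Rightarrow> nat \<Rightarrow> complex"
  assumes coprime_rows: "\<forall>i<n. Gcd (a i ` {..<m}) = 1"
    and alpha_sum: "(\<Sum>i<n. \<alpha> i) = 0"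
    and cyclic_ineq:
      "\<forall>k::nat. k > 0 \<longrightarrow>
         (\<forall>(N :: (nat \<Rightarrow> int) measure) (Z :: nat \<Rightarrow> (nat \<Rightarrow> int) \<Rightarrow> int).
            prob_space N \<longrightarrow>
            prob_space.indep_vars N (\<lambda>_. count_space UNIV) Z {..<m} \<longrightarrow>
            (\<forall>j<m. \<forall>\<omega>\<in>space N. Z j \<omega> \<in> {0..<int k}) \<longrightarrow>
            (\<Sum>i<n. \<alpha> i * prob_space.entropy N 2 (count_space UNIV)
                       (\<lambda>\<omega>. (\<Sum>j<m. a i j * Z j \<omega>) mod int k)) \<le> 0)"
    and M_prob: "prob_space M"
    and X_indep: "prob_space.indep_vars M (\<lambda>_. haar p) X {..<m}"
    and X_torus: "\<forall>j<m. \<forall>\<omega>\<in>space M. X j \<omega> \<in> torus p"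
    and X_ac: "\<forall>j<m. absolutely_continuous (haar p) (distr M (haar p) (X j))"
    and entropies_finite:
      "\<forall>i<n. \<exists>f. information_space.finite_entropy M 2 (haar p)
                    (\<lambda>\<omega>. torus_lincomb p m (a i) (\<lambda>j. X j \<omega>)) f"
  shows "(\<Sum>i<n. \<alpha> i * prob_space.entropy M 2 (haar p)
                    (\<lambda>\<omega>. torus_lincomb p m (a i) (\<lambda>j. X j \<omega>))) \<le> 0"
proof (cases "n = 0")
  case False
  \<comment> \<open>Any row has Gcd 1, which the empty row does not.\<close>
  have m_pos: "0 < m" using coprime_rows False by (cases m) auto
  have "(\<lambda>N. \<Sum>i<n. \<alpha> i * (prob_space.entropy M 2 (count_space UNIV)
        (\<lambda>\<omega>. coprime_grid.cell_sum p (prime_moduli N) m (a i) (\<lambda>j. X j \<omega>))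
      - log 2 (coprime_grid.order p (prime_moduli N))))
    \<longlonglongrightarrow> (\<Sum>i<n. \<alpha> i * prob_space.entropy M 2 (haar p) (\<lambda>\<omega>. torus_lincomb p m (a i) (\<lambda>j. X j \<omega>)))"
  proof (intro tendsto_sum tendsto_mult tendsto_const)
    fix i assume "i \<in> {..<n}"
    thus "(\<lambda>N. prob_space.entropy M 2 (count_space UNIV)
          (\<lambda>\<omega>. coprime_grid.cell_sum p (prime_moduli N) m (a i) (\<lambda>j. X j \<omega>))
        - log 2 (coprime_grid.order p (prime_moduli N)))
      \<longlonglongrightarrow> prob_space.entropy M 2 (haar p) (\<lambda>\<omega>. torus_lincomb p m (a i) (\<lambda>j. X j \<omega>))"
      using coprime_rows entropies_finite
      by (blast intro: entropy_cell_sum_tendsto[OF M_prob X_indep X_torus X_ac])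
  qed
  moreover have "(\<Sum>i<n. \<alpha> i * (prob_space.entropy M 2 (count_space UNIV)
        (\<lambda>\<omega>. coprime_grid.cell_sum p (prime_moduli N) m (a i) (\<lambda>j. X j \<omega>))
      - log 2 (coprime_grid.order p (prime_moduli N)))) \<le> 0" for N
  proof -
    interpret coprime_grid p "prime_moduli N" by (rule coprime_grid_prime_moduli)
    have "(\<Sum>i<n. \<alpha> i * prob_space.entropy M 2 (count_space UNIV) (\<lambda>\<omega>. cell_sum m (a i) (\<lambda>j. X j \<omega>))) \<le> 0"
      using cyclic_ineq order_pos by (intro cell_sum_ineq[OF M_prob X_indep m_pos]) blast
    moreover have "(\<Sum>i<n. \<alpha> i * log 2 order) = 0"
      by (simp add: alpha_sum flip: sum_distrib_right)
    ultimately show ?thesis by (simp add: right_diff_distrib sum_subtractf)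
  qed
  ultimately show ?thesis by (intro LIMSEQ_le_const2) auto
qed simp

end
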